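(* Let $\mathcal S$ be the class of ordered simplicial complexes lying in both QE and QC. For $\Psi\in\mathcal S$ set $$f(\Psi,x)=\sum_{B}x^{|IA(B,\mathrm{nbc}(\Psi))|}\in\mathbb Z[x],$$ the sum being over the bases $B$ of $\mathrm{nbc}(\Psi)$. Then $f$ is a Tutte-Grothendieck invariant on $\mathcal S$. Consequently, if $\Psi\in\mathcal S$ and $B$ is a basis of $\mathrm{nbc}(\Psi)$, then $IA(B,\Psi)=IA(B,\mathrm{nbc}(\Psi))$.
   Context: An ordered simplicial complex is a pair $\Psi=(E,\Delta)$ with $E$ a finite totally ordered set and $\Delta\subseteq 2^E$ a simplicial complex (closed under taking subsets, $\emptyset\in\Delta$). Two such complexes are isomorphic if the ground sets have the same cardinality and the unique order-preserving bijection between them induces a bijection of the complexes. Elements of $\Delta$ are independent sets; inclusion-maximal ones are bases; inclusion-minimal subsets of $E$ not in $\Delta$ are circuits. $\Psi$ is pure if all bases have the same cardinality. A loop is an element of $E$ in no basis; a vertex is an element of $E$ that is not a loop; a coloop is an element lying in every basis. The lexicographic order on subsets is the dictionary order on increasingly sorted lists. $\Psi|_A=(A,\{I\in\Delta:I\subseteq A\})$. QE: the class of $\Psi$ that are pure and such that for all bases $B_1,B_2$ and $b_1\in B_1\setminus B_2$ with $b_1>\max(B_2\setminus B_1)$, there is $b_2\in B_2\setminus B_1$ with $(B_1\setminus\{b_1\})\cup\{b_2\}\in\Delta$. QC: the class of $\Psi$ such that if $C_1\neq C_2$ are circuits and $c\in C_1\cap C_2$ satisfies $c<\max (C_1\triangle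 C_2)$, then there is a circuit $C_3\subseteq (C_1\cup C_2)\setminus\{c\}$. A broken circuit of $\Psi$ is a set $C\setminus\{c\}$ where $C$ is a circuit and $c$ is the smallest element of $C$. $\mathrm{nbc}(\Psi)$ is the complex on $E$ whose bases are the bases of $\Psi$ containing no broken circuit (void, with no bases, if there are none; this happens when $\Psi$ has a loop, and then the sum defining $f$ is $0$). For a basis $B$ of an ordered complex $\Gamma$ ($\Gamma=\Psi$ or $\mathrm{nbc}(\Psi)$), $b\in B$ is internally active if $B$ is the lexicographically smallest basis of $\Gamma$ containing $B\setminus\{b\}$; $IA(B,\Gamma)$ is the set of internally active elements. A Tutte-Grothendieck invariant on $\mathcal S$ with values in a ring $R$ is a map $f$ assigning to each $\Psi\in\mathcal S$ an element $f(\Psi)\in R$, equal on isomorphic complexes, such that: $f(\Psi)=f(\Psi|_{\{e\}})\,f(\Psi|_{E\setminus\{e\}})$ if $e\in E$ is a loop or a coloop; and $f(\Psi)=f(\Psi/e)+f(\Psi\setminus e)$ if $e$ is the largest non-coloop vertex of $\Psi$, where $\Psi\setminus e=\Psi|_{E\setminus\{e\}}$ and $\Psi/e=(E\setminus\{e\},\{J\subseteq E\setminus\{e\}:J\cup\{e\}\in\Delta\})$. *)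

theory Defs
  imports "HOL-Computational_Algebra.Polynomial"
begin

text \<open>
  A pair \<open>(E, \<Delta>)\<close>; the total order on the ground set \<open>E\<close> is the one of the type class.
\<close>

type_synonym 'a ocomplex = "'a set \<times> 'a set set"

definition ground :: "'a ocomplex \<Rightarrow> 'a set" where
  "ground \<Psi> = fst \<Psi>"

definition faces :: "'a ocomplex \<Rightarrow> 'a set set" where
  "faces \<Psi> = snd \<Psi>"

definition ordered_complex :: "'a::linorder ocomplex \<Rightarrow> bool" where
  "ordered_complex \<Psi> \<longleftrightarrow>
     finite (ground \<Psi>) \<and> faces \<Psi> \<subseteq> Pow (ground \<Psi>) \<and> {} \<in> faces \<Psi> \<and>
     (\<forall>I \<in> faces \<Psi>. \<forall>J. J \<subseteq> I \<longrightarrow> J \<in> faces \<Psi>)"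

definition isomorphic :: "'a::linorder ocomplex \<Rightarrow> 'b::linorder ocomplex \<Rightarrow> bool" where
  "isomorphic \<Psi> \<Phi> \<longleftrightarrow>
     (\<exists>\<phi>. bij_betw \<phi> (ground \<Psi>) (ground \<Phi>) \<and> strict_mono_on (ground \<Psi>) \<phi> \<and>
          bij_betw ((`) \<phi>) (faces \<Psi>) (faces \<Phi>))"

definition bases :: "'a ocomplex \<Rightarrow> 'a set set" where
  "bases \<Psi> = {B \<in> faces \<Psi>. \<forall>I \<in> faces \<Psi>. B \<subseteq> I \<longrightarrow> I = B}"

definition circuits :: "'a ocomplex \<Rightarrow> 'a set set" where
  "circuits \<Psi> = {C. C \<subseteq> ground \<Psi> \<and> C \<notin> faces \<Psi> \<and> (\<forall>D. D \<subset> C \<longrightarrow> D \<in> faces \<Psi>)}"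

definition pure :: "'a ocomplex \<Rightarrow> bool" where
  "pure \<Psi> \<longleftrightarrow> (\<forall>B\<^sub>1 \<in> bases \<Psi>. \<forall>B\<^sub>2 \<in> bases \<Psi>. card B\<^sub>1 = card B\<^sub>2)"

definition loop :: "'a ocomplex \<Rightarrow> 'a \<Rightarrow> bool" where
  "loop \<Psi> e \<longleftrightarrow> e \<in> ground \<Psi> \<and> (\<forall>B \<in> bases \<Psi>. e \<notin> B)"

definition vertex :: "'a ocomplex \<Rightarrow> 'a \<Rightarrow> bool" where
  "vertex \<Psi> e \<longleftrightarrow> e \<in> ground \<Psi> \<and> \<not> loop \<Psi> e"

definition coloop :: "'a ocomplex \<Rightarrow> 'a \<Rightarrow> bool" where
  "coloop \<Psi> e \<longleftrightarrow> e \<in> ground \<Psi> \<and> (\<forall>B \<in> bases \<Psi>. e \<in> B)"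

definition largest_noncoloop_vertex :: "'a::linorder ocomplex \<Rightarrow> 'a \<Rightarrow> bool" where
  "largest_noncoloop_vertex \<Psi> e \<longleftrightarrow>
     vertex \<Psi> e \<and> \<not> coloop \<Psi> e \<and>
     (\<forall>v. vertex \<Psi> v \<and> \<not> coloop \<Psi> v \<longrightarrow> v \<le> e)"

definition restriction :: "'a ocomplex \<Rightarrow> 'a set \<Rightarrow> 'a ocomplex" where
  "restriction \<Psi> A = (A, {I \<in> faces \<Psi>. I \<subseteq> A})"

definition deletion :: "'a ocomplex \<Rightarrow> 'a \<Rightarrow> 'a ocomplex" where
  "deletion \<Psi> e = restriction \<Psi> (ground \<Psi> - {e})"

definition contraction :: "'a ocomplex \<Rightarrow> 'a \<Rightarrow> 'a ocomplex" where
  "contraction \<Psi> e =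
     (ground \<Psi> - {e}, {J. J \<subseteq> ground \<Psi> - {e} \<and> J \<union> {e} \<in> faces \<Psi>})"

text \<open>
  Both occurrences of \<open>Max\<close> below are taken over nonempty finite sets: distinct bases
  are incomparable, and the circuits in \<open>QC\<close> are distinct.
\<close>

definition QE :: "'a::linorder ocomplex set" where
  "QE = {\<Psi>. ordered_complex \<Psi> \<and> pure \<Psi> \<and>
     (\<forall>B\<^sub>1 \<in> bases \<Psi>. \<forall>B\<^sub>2 \<in> bases \<Psi>. \<forall>b\<^sub>1 \<in> B\<^sub>1 - B\<^sub>2.
        b\<^sub>1 > Max (B\<^sub>2 - B\<^sub>1) \<longrightarrow> (\<exists>b\<^sub>2 \<in> B\<^sub>2 - B\<^sub>1. (B\<^sub>1 - {b\<^sub>1}) \<union> {b\<^sub>2} \<in> faces \<Psi>))}"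

definition QC :: "'a::linorder ocomplex set" where
  "QC = {\<Psi>. ordered_complex \<Psi> \<and>
     (\<forall>C\<^sub>1 \<in> circuits \<Psi>. \<forall>C\<^sub>2 \<in> circuits \<Psi>. \<forall>c \<in> C\<^sub>1 \<inter> C\<^sub>2.
        C\<^sub>1 \<noteq> C\<^sub>2 \<and> c < Max ((C\<^sub>1 - C\<^sub>2) \<union> (C\<^sub>2 - C\<^sub>1)) \<longrightarrow>
        (\<exists>C\<^sub>3 \<in> circuits \<Psi>. C\<^sub>3 \<subseteq> (C\<^sub>1 \<union> C\<^sub>2) - {c}))}"

definition broken_circuits :: "'a::linorder ocomplex \<Rightarrow> 'a set set" where
  "broken_circuits \<Psi> = {C - {Min C} | C. C \<in> circuits \<Psi>}"

text \<open>
  The face set of \<open>nbc \<Psi>\<close> is empty (not \<open>{{}}\<close>) if every basis contains a broken circuit;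
  then \<open>bases (nbc \<Psi>) = {}\<close>.
\<close>

definition nbc :: "'a::linorder ocomplex \<Rightarrow> 'a ocomplex" where
  "nbc \<Psi> = (ground \<Psi>,
     {I. \<exists>B \<in> bases \<Psi>. (\<forall>D \<in> broken_circuits \<Psi>. \<not> D \<subseteq> B) \<and> I \<subseteq> B})"

definition lex_le :: "'a::linorder set \<Rightarrow> 'a set \<Rightarrow> bool" where
  "lex_le A B \<longleftrightarrow>
     A = B \<or> (sorted_list_of_set A, sorted_list_of_set B) \<in> lexord {(x, y). x < y}"

definition internally_active :: "'a::linorder ocomplex \<Rightarrow> 'a set \<Rightarrow> 'a \<Rightarrow> bool" where
  "internally_active \<Gamma> B b \<longleftrightarrow>
     b \<in> B \<and> B \<in> bases \<Gamma> \<and> (\<forall>B' \<in> bases \<Gamma>. B - {b} \<subseteq> B' \<longrightarrow> lex_le B B')"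

definition IA :: "'a::linorder set \<Rightarrow> 'a ocomplex \<Rightarrow> 'a set" where
  "IA B \<Gamma> = {b. internally_active \<Gamma> B b}"

text \<open>
  For \<open>f\<close> to be a map on the class \<open>S\<close>, the minors occurring on the right-hand sides must belong
  to \<open>S\<close>.  As \<open>f\<close> is a total function here, this is stated explicitly.
\<close>

definition tutte_grothendieck_invariant ::
  "'a::linorder ocomplex set \<Rightarrow> ('a ocomplex \<Rightarrow> 'r::ring_1) \<Rightarrow> bool" where
  "tutte_grothendieck_invariant S f \<longleftrightarrow>
     (\<forall>\<Psi> \<in> S. \<forall>\<Phi> \<in> S. isomorphic \<Psi> \<Phi> \<longrightarrow> f \<Psi> = f \<Phi>) \<and>
     (\<forall>\<Psi> \<in> S. \<forall>e. loop \<Psi> e \<or> coloop \<Psi> e \<longrightarrow>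
        restriction \<Psi> {e} \<in> S \<and> restriction \<Psi> (ground \<Psi> - {e}) \<in> S \<and>
        f \<Psi> = f (restriction \<Psi> {e}) * f (restriction \<Psi> (ground \<Psi> - {e}))) \<and>
     (\<forall>\<Psi> \<in> S. \<forall>e. largest_noncoloop_vertex \<Psi> e \<longrightarrow>
        contraction \<Psi> e \<in> S \<and> deletion \<Psi> e \<in> S \<and>
        f \<Psi> = f (contraction \<Psi> e) + f (deletion \<Psi> e))"

definition nbc_activity_poly :: "'a::linorder ocomplex \<Rightarrow> int poly" where
  "nbc_activity_poly \<Psi> = (\<Sum>B \<in> bases (nbc \<Psi>). monom 1 (card (IA B (nbc \<Psi>))))"

end

theory Submission
  imports Defs
begin

text \<open>
  By quasi circuit elimination, a basis \<open>B\<close> without broken circuits can be exchanged to a smaller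
  basis at \<open>b\<close> only if it can be so exchanged to one without broken circuits. Hence the activities
  in \<open>\<Psi>\<close> and in \<open>nbc \<Psi>\<close> agree, and it suffices to follow \<open>IA B \<Psi>\<close> through deletion and
  contraction. The largest non-coloop vertex \<open>e\<close> is never the minimum of a circuit, so the nbc bases
  avoiding (containing) \<open>e\<close> are those of the deletion (contraction); by \<open>QE\<close>, \<open>e\<close> is never
  active, and being largest it does not affect the activity of the other elements. A coloop is always
  active, which gives the factor \<open>x\<close>.
\<close>

section \<open>Lexicographic order and internal activity\<close>

text \<open>The equality of activities is worded as a consequence of the recursion, yet it comes
  before it here: \<open>nbc \<Psi>\<close> may be void and is awkward under minors, whereas
  activity in the pure complex \<Psi> is a condition on one-element exchanges between bases, and
  these can be compared with those of a minor one by one.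

  Two obstacles shape the treatment of minors. Deleting an element may lower the dimension, and then
  the bases of the deletion are no bases of \<Psi>. This is what happens for a coloop, so there the
  restriction to the other elements is read as a contraction, and one formula for the contraction
  serves both the coloop rule and the deletion-contraction rule. Moreover, the circuits of a
  contraction at a vertex \<open>e\<close> are only the inclusion-minimal sets among the
  \<open>C - {e}\<close>, so broken circuits do not correspond one to one; what saves the comparison
  is that a circuit lying inside \<open>C - {e}\<close> still contains \<open>Min C\<close> in the
  cases that matter.

  A loop is a circuit whose broken circuit is empty, so the loop rule reads \<open>0 = 0\<close> and
  only membership of the minors has to be shown.\<close>

lemma lexord_insort:
  fixes x y :: "'a::linorder"
  assumes "x < y" "x \<notin> set xs"
  shows "(insort x xs, insort y xs) \<in> lexord {(x, y). x < y}"
  using assms by (induction xs) auto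

text \<open>The two sorted lists arise from one common list, and the smaller of the two new elements
  decides at the first position where they differ. Activity compares only bases that are related in
  this way.\<close>

lemma lex_le_insert_iff:
  fixes x y :: "'a::linorder"
  assumes "finite A" "x \<notin> A" "y \<notin> A"
  shows "lex_le (insert x A) (insert y A) \<longleftrightarrow> x \<le> y"
proof -
  let ?l = "sorted_list_of_set A" and ?r = "{(x, y). x < y} :: ('a \<times> 'a) set"
  have eq: "sorted_list_of_set (insert x A) = insort x ?l"
    "sorted_list_of_set (insert y A) = insort y ?l"
    using assms by (simp_all add: sorted_list_of_set_insert)
  have notin: "x \<notin> set ?l" "y \<notin> set ?l"
    using assms by auto
  have asym: "(u, v) \<notin> lexord ?r" if "(v, u) \<in> lexord ?r" for u v :: "'a list"
    using lexord_asymmetric[OF _ that] by (metis asymI case_prodD less_asym mem_Collect_eq)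
  have neq: "insert x A \<noteq> insert y A" if "x \<noteq> y"
    using that assms by auto
  show ?thesis
    using lexord_insort[of x y ?l] lexord_insort[of y x ?l] notin asym neq
    unfolding lex_le_def eq by (cases x y rule: linorder_cases) auto
qed

section \<open>Bases, loops, circuits and activity in an ordered complex\<close>

lemma basis_subset_face_imp_eq:
  assumes "B \<in> bases \<Psi>" "I \<in> faces \<Psi>" "B \<subseteq> I"
  shows "I = B"
  using assms by (auto simp: bases_def)

lemma basisI:
  assumes "B \<in> faces \<Psi>" "\<And>I. I \<in> faces \<Psi> \<Longrightarrow> B \<subseteq> I \<Longrightarrow> I = B"
  shows "B \<in> bases \<Psi>"
  unfolding bases_def using assms by blast

lemma basis_face: "B \<in> bases \<Psi> \<Longrightarrow> B \<in> faces \<Psi>"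
  by (simp add: bases_def)

lemma pure_card: "pure \<Psi> \<Longrightarrow> B\<^sub>1 \<in> bases \<Psi> \<Longrightarrow> B\<^sub>2 \<in> bases \<Psi> \<Longrightarrow> card B\<^sub>1 = card B\<^sub>2"
  unfolding pure_def by blast

context
  fixes \<Psi> :: "'a::linorder ocomplex"
  assumes oc: "ordered_complex \<Psi>"
begin

lemma finite_ground: "finite (ground \<Psi>)"
  and empty_face: "{} \<in> faces \<Psi>"
  and face_subset_ground: "I \<in> faces \<Psi> \<Longrightarrow> I \<subseteq> ground \<Psi>"
  and face_subset: "I \<in> faces \<Psi> \<Longrightarrow> J \<subseteq> I \<Longrightarrow> J \<in> faces \<Psi>"
  using oc by (auto simp: ordered_complex_def)

lemma finite_face: "I \<in> faces \<Psi> \<Longrightarrow> finite I"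
  using finite_ground face_subset_ground finite_subset by blast

lemma finite_faces: "finite (faces \<Psi>)"
  using finite_ground face_subset_ground by (meson PowI finite_Pow_iff finite_subset subsetI)

lemma face_extends_to_basis:
  assumes "I \<in> faces \<Psi>"
  obtains B where "B \<in> bases \<Psi>" "I \<subseteq> B"
  using finite_has_maximal2[OF finite_faces assms]
  by (auto simp: bases_def)

lemma loop_iff: "loop \<Psi> e \<longleftrightarrow> e \<in> ground \<Psi> \<and> {e} \<notin> faces \<Psi>"
proof -
  have "{e} \<notin> faces \<Psi>" if "\<forall>B\<in>bases \<Psi>. e \<notin> B"
    using that face_extends_to_basis[of "{e}"] by auto
  moreover have "e \<notin> B" if "{e} \<notin> faces \<Psi>" "B \<in> bases \<Psi>" for B
    using that face_subset[OF basis_face, of B "{e}"] by auto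
  ultimately show ?thesis
    unfolding loop_def by blast
qed

lemma vertex_iff: "vertex \<Psi> e \<longleftrightarrow> {e} \<in> faces \<Psi>"
  using loop_iff face_subset_ground[of "{e}"] by (auto simp: vertex_def)

text \<open>The complex is a cone with apex \<open>e\<close>: a face extends to a basis, and that
  basis contains \<open>e\<close>.\<close>

lemma coloop_insert_face:
  assumes "coloop \<Psi> e" "I \<in> faces \<Psi>"
  shows "insert e I \<in> faces \<Psi>"
proof -
  obtain B where B: "B \<in> bases \<Psi>" "I \<subseteq> B"
    using face_extends_to_basis assms(2) by blast
  then have "insert e I \<subseteq> B"
    using assms(1) by (auto simp: coloop_def)
  then show ?thesis
    using face_subset basis_face B(1) by blast
qed

lemma circuit_no_coloop:
  assumes "C \<in> circuits \<Psi>" "coloop \<Psi> e"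
  shows "e \<notin> C"
proof
  assume "e \<in> C"
  then have "C - {e} \<in> faces \<Psi>" and "C = insert e (C - {e})"
    using assms(1) by (auto simp: circuits_def)
  then show False
    using coloop_insert_face[OF assms(2)] assms(1) by (metis (lifting) circuits_def mem_Collect_eq)
qed

lemma circuit_finite: "C \<in> circuits \<Psi> \<Longrightarrow> finite C"
  and circuit_nonempty: "C \<in> circuits \<Psi> \<Longrightarrow> C \<noteq> {}"
  using finite_ground empty_face by (auto simp: circuits_def intro: finite_subset)

lemma circuit_Min: "C \<in> circuits \<Psi> \<Longrightarrow> Min C \<in> C"
  by (simp add: circuit_finite circuit_nonempty)

lemma dependent_contains_circuit:
  assumes "X \<subseteq> ground \<Psi>" "X \<notin> faces \<Psi>"
  obtains C where "C \<in> circuits \<Psi>" "C \<subseteq> X"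
proof -
  define D where "D = {Y. Y \<subseteq> X \<and> Y \<notin> faces \<Psi>}"
  have "finite D"
    using finite_subset[OF assms(1) finite_ground] by (simp add: D_def)
  moreover have "X \<in> D"
    using assms by (simp add: D_def)
  ultimately have "\<exists>C\<in>D. C \<subseteq> X \<and> (\<forall>Y\<in>D. Y \<subseteq> C \<longrightarrow> C = Y)"
    by (rule finite_has_minimal2)
  then obtain C where C: "C \<subseteq> X" "C \<notin> faces \<Psi>" and min: "\<forall>Y\<in>D. Y \<subseteq> C \<longrightarrow> C = Y"
    by (auto simp: D_def)
  have "Y \<in> faces \<Psi>" if "Y \<subset> C" for Y
  proof (rule ccontr)
    assume "Y \<notin> faces \<Psi>"
    then have "Y \<in> D"
      using that C(1) unfolding D_def by blast
    then show False
      using min that by blast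
  qed
  then have "C \<in> circuits \<Psi>"
    using C assms(1) by (simp add: circuits_def)
  then show ?thesis
    using that C by blast
qed

lemma pure_face_basis:
  assumes "pure \<Psi>" "B \<in> bases \<Psi>" "I \<in> faces \<Psi>" "card I = card B"
  shows "I \<in> bases \<Psi>"
proof -
  obtain B' where B': "B' \<in> bases \<Psi>" "I \<subseteq> B'"
    using face_extends_to_basis assms(3) by blast
  then have "card I = card B'"
    using pure_card[OF assms(1,2) B'(1)] assms(4) by simp
  then have "I = B'"
    using B' finite_face[OF basis_face] by (simp add: card_subset_eq)
  then show ?thesis
    using B' by simp
qed

lemma pure_exchange_basis:
  assumes "pure \<Psi>" "B \<in> bases \<Psi>" "b \<in> B" "b' \<notin> B" "insert b' (B - {b}) \<in> faces \<Psi>"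
  shows "insert b' (B - {b}) \<in> bases \<Psi>"
proof -
  have "finite B"
    using assms(2) basis_face finite_face by blast
  then have "card (insert b' (B - {b})) = card B"
    using assms(3,4) by (metis Diff_iff card.insert card.remove finite_Diff)
  then show ?thesis
    using pure_face_basis assms by blast
qed

text \<open>The bases of \<Psi> form an antichain, so those generating the faces of
  \<open>nbc \<Psi>\<close> stay maximal there. In the void case both sides are empty.\<close>

lemma bases_nbc: "bases (nbc \<Psi>) = {B \<in> bases \<Psi>. \<forall>D\<in>broken_circuits \<Psi>. \<not> D \<subseteq> B}" (is "_ = ?N")
proof -
  have *: "B = B'" if "B \<in> bases \<Psi>" "B' \<in> bases \<Psi>" "B \<subseteq> B'" for B B'
    using that by (auto simp: bases_def)
  define N where "N = ?N"
  have faces: "I \<in> faces (nbc \<Psi>) \<longleftrightarrow> (\<exists>B\<in>N. I \<subseteq> B)" for I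
    by (auto simp: nbc_def faces_def N_def)
  have facesI: "I \<in> faces (nbc \<Psi>)" if "B \<in> N" "I \<subseteq> B" for B I
    unfolding faces using that by (rule bexI[rotated])
  have "B \<in> bases (nbc \<Psi>) \<longleftrightarrow> B \<in> N" for B
  proof
    assume B: "B \<in> bases (nbc \<Psi>)"
    then obtain B' where B': "B' \<in> N" "B \<subseteq> B'"
      using faces[THEN iffD1, OF basis_face] by blast
    then have "B' \<in> faces (nbc \<Psi>)"
      using facesI by simp
    then have "B' = B"
      by (rule basis_subset_face_imp_eq[OF B _ B'(2)])
    then show "B \<in> N"
      using B' by simp
  next
    assume B: "B \<in> N"
    have "I = B" if I: "I \<in> faces (nbc \<Psi>)" "B \<subseteq> I" for I
    proof -
      obtain B' where B': "B' \<in> N" "I \<subseteq> B'"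
        using faces[THEN iffD1, OF I(1)] by blast
      then have "B = B'"
        using * B I(2) by (simp add: N_def)
      then show ?thesis
        using B' I(2) by simp
    qed
    moreover have "B \<in> faces (nbc \<Psi>)"
      using facesI[OF B] by simp
    ultimately show "B \<in> bases (nbc \<Psi>)"
      by (rule basisI[rotated])
  qed
  then show ?thesis
    unfolding N_def by blast
qed

lemma nbc_basis_iff:
  "B \<in> bases (nbc \<Psi>) \<longleftrightarrow> B \<in> bases \<Psi> \<and> (\<forall>C\<in>circuits \<Psi>. \<not> C - {Min C} \<subseteq> B)"
  by (auto simp: bases_nbc broken_circuits_def)

lemma bases_nbc_subset: "bases (nbc \<Psi>) \<subseteq> bases \<Psi>"
  by (auto simp: bases_nbc)

text \<open>By purity, a basis containing \<open>B - {b}\<close> is \<open>B\<close> itself or a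
  single exchange \<open>insert b' (B - {b})\<close>, and the lexicographic comparison becomes one
  of \<open>b\<close> with \<open>b'\<close>. The complex \<Gamma> is kept general so that the
  criterion covers both \<Psi> and \<open>nbc \<Psi>\<close>.\<close>

lemma internally_active_iff:
  assumes "pure \<Psi>" "bases \<Gamma> \<subseteq> bases \<Psi>" "B \<in> bases \<Gamma>"
  shows "internally_active \<Gamma> B b \<longleftrightarrow>
    b \<in> B \<and> (\<forall>b'. b' \<notin> B \<longrightarrow> insert b' (B - {b}) \<in> bases \<Gamma> \<longrightarrow> b < b')"
proof (cases "b \<in> B")
  case True
  have fin: "finite X" if "X \<in> bases \<Gamma>" for X
    using that assms(2) basis_face finite_face by blast
  have lex: "lex_le B (insert b' (B - {b})) \<longleftrightarrow> b \<le> b'" if "b' \<notin> B" for b'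
    using lex_le_insert_iff[of "B - {b}" b b'] True that fin[OF assms(3)] by (auto simp: insert_absorb)
  have ex: "\<exists>b'. b' \<notin> B \<and> B' = insert b' (B - {b})"
    if "B' \<in> bases \<Gamma>" "B - {b} \<subseteq> B'" "B' \<noteq> B" for B'
  proof -
    have card: "card B' = card B"
      using that assms pure_card by blast
    then have "\<not> B' \<subseteq> B"
      using that fin[OF assms(3)] card_subset_eq by blast
    then obtain b' where b': "b' \<in> B'" "b' \<notin> B"
      by blast
    then have "card (insert b' (B - {b})) = card B'"
      using True fin[OF assms(3)] card by (metis Diff_iff card.insert card.remove finite_Diff)
    then have "insert b' (B - {b}) = B'"
      using that b' fin card_subset_eq[of B' "insert b' (B - {b})"] by auto
    then show ?thesis
      using b' by blast
  qed
  have refl: "lex_le B B"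
    by (simp add: lex_le_def)
  have "(\<forall>B'\<in>bases \<Gamma>. B - {b} \<subseteq> B' \<longrightarrow> lex_le B B') \<longleftrightarrow>
    (\<forall>b'. b' \<notin> B \<longrightarrow> insert b' (B - {b}) \<in> bases \<Gamma> \<longrightarrow> b < b')" (is "?l \<longleftrightarrow> ?r")
  proof
    assume ?l
    then have "b \<le> b'" if "b' \<notin> B" "insert b' (B - {b}) \<in> bases \<Gamma>" for b'
      using that lex by blast
    then show ?r
      using True by (metis order_le_imp_less_or_eq)
  next
    assume ?r
    then show ?l
      using ex lex refl by (metis less_imp_le)
  qed
  then show ?thesis
    using True assms(3) by (simp add: internally_active_def)
qed (simp add: internally_active_def)

lemma IA_eq:
  assumes "pure \<Psi>" "B \<in> bases \<Psi>"
  shows "IA B \<Psi> = {b\<in>B. \<forall>b'. b' \<notin> B \<longrightarrow> insert b' (B - {b}) \<in> bases \<Psi> \<longrightarrow> b < b'}"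
  using internally_active_iff[OF assms(1) _ assms(2)] by (auto simp: IA_def)

end

section \<open>Activity in a complex and in its broken-circuit complex\<close>

lemma QE_D:
  assumes "\<Psi> \<in> QE"
  shows "ordered_complex \<Psi>" "pure \<Psi>"
  using assms by (auto simp: QE_def)

lemma QE_I:
  assumes "ordered_complex \<Psi>"
    and "\<And>B1 B2. B1 \<in> bases \<Psi> \<Longrightarrow> B2 \<in> bases \<Psi> \<Longrightarrow> card B1 = card B2"
    and "\<And>B1 B2 b1. B1 \<in> bases \<Psi> \<Longrightarrow> B2 \<in> bases \<Psi> \<Longrightarrow> b1 \<in> B1 - B2 \<Longrightarrow> b1 > Max (B2 - B1) \<Longrightarrow>
      \<exists>b2\<in>B2 - B1. (B1 - {b1}) \<union> {b2} \<in> faces \<Psi>"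
  shows "\<Psi> \<in> QE"
  unfolding QE_def pure_def using assms by blast

text \<open>
  Take \<open>b'\<close> least.  A broken circuit \<open>C - {c}\<close> inside \<open>B - b + b'\<close> contains \<open>b'\<close>, and if
  \<open>B - b + c\<close> were dependent, eliminating \<open>c\<close> would produce a circuit inside \<open>B - b + b'\<close>;
  so \<open>c < b'\<close> contradicts the choice of \<open>b'\<close>.
\<close>

lemma nbc_exchange:
  fixes \<Psi> :: "'a::linorder ocomplex"
  assumes S: "\<Psi> \<in> QE \<inter> QC" and B: "B \<in> bases (nbc \<Psi>)" and b: "b \<in> B"
    and b0: "b0 < b" "b0 \<notin> B" "insert b0 (B - {b}) \<in> bases \<Psi>"
  shows "\<exists>b'. b' < b \<and> b' \<notin> B \<and> insert b' (B - {b}) \<in> bases (nbc \<Psi>)"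
proof -
  have oc: "ordered_complex \<Psi>" and pu: "pure \<Psi>"
    using S QE_D[of \<Psi>] by blast+
  have Bb: "B \<in> bases \<Psi>" and Bn: "\<And>C. C \<in> circuits \<Psi> \<Longrightarrow> \<not> C - {Min C} \<subseteq> B"
    using B nbc_basis_iff[OF oc] by simp_all
  define X where "X = {b'. b' < b \<and> b' \<notin> B \<and> insert b' (B - {b}) \<in> bases \<Psi>}"
  have "X \<subseteq> ground \<Psi>"
    using face_subset_ground[OF oc] basis_face by (fastforce simp: X_def)
  then have finX: "finite X"
    using finite_ground[OF oc] finite_subset by blast
  have "X \<noteq> {}"
    using b0 by (auto simp: X_def)
  define b' where "b' = Min X"
  have "b' \<in> X"
    using finX \<open>X \<noteq> {}\<close> by (simp add: b'_def)
  then have b': "b' < b" "b' \<notin> B" "insert b' (B - {b}) \<in> bases \<Psi>"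
    by (auto simp: X_def)
  have min: "b' \<le> c" if "c \<in> X" for c
    using finX that by (simp add: b'_def)
  have "\<not> C - {Min C} \<subseteq> insert b' (B - {b})" if C: "C \<in> circuits \<Psi>" for C
  proof
    assume sub: "C - {Min C} \<subseteq> insert b' (B - {b})"
    let ?c = "Min C"
    have cC: "?c \<in> C"
      using circuit_Min[OF oc C] .
    have indep: "\<not> C' \<subseteq> insert b' (B - {b})" if "C' \<in> circuits \<Psi>" for C'
      using that face_subset[OF oc basis_face[OF b'(3)], of C'] by (auto simp: circuits_def)
    have b'C: "b' \<in> C" "b' \<noteq> ?c"
      using sub Bn[OF C] by auto
    then have lt: "?c < b'"
      using circuit_finite[OF oc C] by (simp add: order_less_le)
    \<comment> \<open>Since \<open>?c < b' < b\<close>, an element \<open>?c\<close> of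
      \<open>B\<close> would lie in \<open>B - {b}\<close>, and then all of \<open>C\<close> would
      lie in the independent set \<open>insert b' (B - {b})\<close>.\<close>
    have c: "?c \<notin> B"
      using indep[OF C] sub lt b'(1) by auto
    have "insert ?c (B - {b}) \<in> faces \<Psi>"
    proof (rule ccontr)
      assume "insert ?c (B - {b}) \<notin> faces \<Psi>"
      moreover have "insert ?c (B - {b}) \<subseteq> ground \<Psi>"
        using face_subset_ground[OF oc basis_face[OF Bb]] cC C by (auto simp: circuits_def)
      ultimately obtain C' where C': "C' \<in> circuits \<Psi>" "C' \<subseteq> insert ?c (B - {b})"
        using dependent_contains_circuit[OF oc] by blast
      have cC': "?c \<in> C'"
      proof (rule ccontr)
        assume "?c \<notin> C'"
        then have "C' \<subseteq> insert b' (B - {b})"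
          using C'(2) by blast
        then show False
          using indep C'(1) by blast
      qed
      \<comment> \<open>So \<open>b'\<close> lies in the symmetric difference of \<open>C\<close>
        and \<open>C'\<close>; as it exceeds \<open>?c\<close>, it provides the side condition of
        \<open>QC\<close>.\<close>
      have "b' \<notin> C'"
        using C'(2) b'(2) b'C(2) by blast
      then have b'D: "b' \<in> (C - C') \<union> (C' - C)" "C \<noteq> C'"
        using b'C by auto
      have "finite ((C - C') \<union> (C' - C))"
        using circuit_finite[OF oc] C C' by blast
      then have "?c < Max ((C - C') \<union> (C' - C))"
        using lt b'D(1) by (meson Max_ge less_le_trans)
      then obtain C3 where C3: "C3 \<in> circuits \<Psi>" "C3 \<subseteq> C \<union> C' - {?c}"
        using S C C'(1) cC cC' b'D(2) unfolding QC_def by blast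
      then have "C3 \<subseteq> insert b' (B - {b})"
        using sub C'(2) by blast
      then show False
        using indep C3(1) by blast
    qed
    then have "?c \<in> X"
      using pure_exchange_basis[OF oc pu Bb b c] c lt b'(1) by (simp add: X_def)
    then show False
      using min lt by force
  qed
  then show ?thesis
    using b' nbc_basis_iff[OF oc] by auto
qed

lemma IA_nbc:
  fixes \<Psi> :: "'a::linorder ocomplex"
  assumes S: "\<Psi> \<in> QE \<inter> QC" and B: "B \<in> bases (nbc \<Psi>)"
  shows "IA B \<Psi> = IA B (nbc \<Psi>)"
proof -
  have oc: "ordered_complex \<Psi>" and pu: "pure \<Psi>"
    using S QE_D[of \<Psi>] by blast+
  note sub = bases_nbc_subset[OF oc]
  have "internally_active \<Psi> B b \<longleftrightarrow> internally_active (nbc \<Psi>) B b" for b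
  proof
    assume "internally_active \<Psi> B b"
    then show "internally_active (nbc \<Psi>) B b"
      using sub B by (auto simp: internally_active_def)
  next
    assume "internally_active (nbc \<Psi>) B b"
    then have *: "b \<in> B" "\<And>b'. b' \<notin> B \<Longrightarrow> insert b' (B - {b}) \<in> bases (nbc \<Psi>) \<Longrightarrow> b < b'"
      using internally_active_iff[OF oc pu sub B] by blast+
    have "b < b'" if "b' \<notin> B" "insert b' (B - {b}) \<in> bases \<Psi>" for b'
    proof (rule ccontr)
      assume "\<not> b < b'"
      then have "b' < b"
        using that *(1) by (metis linorder_neqE)
      then show False
        using nbc_exchange[OF S B *(1) _ that] * by (meson less_asym)
    qed
    then show "internally_active \<Psi> B b"
      using internally_active_iff[OF oc pu subset_refl] B sub *(1) by blast
  qed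
  then show ?thesis
    by (simp add: IA_def)
qed

lemma nbc_activity_poly_eq:
  fixes \<Psi> :: "'a::linorder ocomplex"
  assumes "\<Psi> \<in> QE \<inter> QC"
  shows "nbc_activity_poly \<Psi> = (\<Sum>B\<in>bases (nbc \<Psi>). monom 1 (card (IA B \<Psi>)))"
  unfolding nbc_activity_poly_def using IA_nbc[OF assms] by simp

lemma finite_bases_nbc:
  assumes "ordered_complex \<Psi>"
  shows "finite (bases (nbc \<Psi>))"
proof (rule finite_subset)
  show "bases (nbc \<Psi>) \<subseteq> faces \<Psi>"
    using bases_nbc_subset[OF assms] basis_face by blast
qed (rule finite_faces[OF assms])

section \<open>Isomorphism invariance\<close>

context
  fixes \<Psi> :: "'a::linorder ocomplex" and \<Phi> :: "'b::linorder ocomplex" and \<phi> :: "'a \<Rightarrow> 'b"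
  assumes oc: "ordered_complex \<Psi>" "ordered_complex \<Phi>"
    and bij: "bij_betw \<phi> (ground \<Psi>) (ground \<Phi>)"
    and mono: "strict_mono_on (ground \<Psi>) \<phi>"
    and bij_faces: "bij_betw ((`) \<phi>) (faces \<Psi>) (faces \<Phi>)"
begin

lemma image_subset_ground: "A \<subseteq> ground \<Psi> \<Longrightarrow> \<phi> ` A \<subseteq> ground \<Phi>"
  using bij_betw_imp_surj_on[OF bij] by auto

lemma subset_groundE:
  assumes "X \<subseteq> ground \<Phi>"
  obtains A where "A \<subseteq> ground \<Psi>" "X = \<phi> ` A"
  using assms unfolding bij_betw_imp_surj_on[OF bij, symmetric] subset_image_iff by auto

lemma image_eq_iff_iso:
  "A \<subseteq> ground \<Psi> \<Longrightarrow> A' \<subseteq> ground \<Psi> \<Longrightarrow> \<phi> ` A = \<phi> ` A' \<longleftrightarrow> A = A'"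
  using bij by (meson bij_betw_def inj_on_image_eq_iff)

lemma image_subset_iff_iso:
  assumes "A \<subseteq> ground \<Psi>" "A' \<subseteq> ground \<Psi>"
  shows "\<phi> ` A \<subseteq> \<phi> ` A' \<longleftrightarrow> A \<subseteq> A'"
  using image_eq_iff_iso[OF Un_least[OF assms] assms(2)] by (simp add: subset_Un_eq image_Un)

lemma image_face_iff:
  assumes "A \<subseteq> ground \<Psi>"
  shows "\<phi> ` A \<in> faces \<Phi> \<longleftrightarrow> A \<in> faces \<Psi>"
proof
  assume "\<phi> ` A \<in> faces \<Phi>"
  then obtain I where "I \<in> faces \<Psi>" "\<phi> ` A = \<phi> ` I"
    using bij_faces by (metis bij_betw_imp_surj_on imageE)
  then show "A \<in> faces \<Psi>"
    using assms image_eq_iff_iso face_subset_ground[OF oc(1)] by metis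
next
  assume "A \<in> faces \<Psi>"
  then show "\<phi> ` A \<in> faces \<Phi>"
    using bij_faces by (auto simp: bij_betw_def)
qed

lemma image_basis_iff:
  assumes A: "A \<subseteq> ground \<Psi>"
  shows "\<phi> ` A \<in> bases \<Phi> \<longleftrightarrow> A \<in> bases \<Psi>"
proof -
  have "(\<phi> ` A \<subseteq> \<phi> ` I \<longrightarrow> \<phi> ` I = \<phi> ` A) \<longleftrightarrow> (A \<subseteq> I \<longrightarrow> I = A)" if "I \<in> faces \<Psi>" for I
    using image_subset_iff_iso[OF A] image_eq_iff_iso[OF _ A] face_subset_ground[OF oc(1) that]
    by simp
  then have "(\<forall>I\<in>faces \<Phi>. \<phi> ` A \<subseteq> I \<longrightarrow> I = \<phi> ` A) \<longleftrightarrow> (\<forall>I\<in>faces \<Psi>. A \<subseteq> I \<longrightarrow> I = A)"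
    unfolding bij_betw_imp_surj_on[OF bij_faces, symmetric] by simp
  then show ?thesis
    using image_face_iff[OF A] by (simp add: bases_def)
qed

lemma image_circuit_iff:
  assumes A: "A \<subseteq> ground \<Psi>"
  shows "\<phi> ` A \<in> circuits \<Phi> \<longleftrightarrow> A \<in> circuits \<Psi>"
proof -
  have A': "\<phi> ` A \<subseteq> ground \<Phi>"
    using image_subset_ground[OF A] .
  have psub: "\<phi> ` D \<subset> \<phi> ` A \<longleftrightarrow> D \<subset> A" if "D \<subseteq> ground \<Psi>" for D
    by (simp only: psubset_eq image_subset_iff_iso[OF that A] image_eq_iff_iso[OF that A])
  have "(\<forall>D. D \<subset> \<phi> ` A \<longrightarrow> D \<in> faces \<Phi>) \<longleftrightarrow> (\<forall>D. D \<subset> A \<longrightarrow> D \<in> faces \<Psi>)"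
  proof (intro iffI allI impI)
    fix D assume *: "\<forall>D. D \<subset> \<phi> ` A \<longrightarrow> D \<in> faces \<Phi>" and D: "D \<subset> A"
    then have DE: "D \<subseteq> ground \<Psi>"
      using A by simp
    have "\<phi> ` D \<in> faces \<Phi>"
      using * D psub[OF DE] by simp
    then show "D \<in> faces \<Psi>"
      using image_face_iff[OF DE] by simp
  next
    fix D assume *: "\<forall>D. D \<subset> A \<longrightarrow> D \<in> faces \<Psi>" and D: "D \<subset> \<phi> ` A"
    then have "D \<subseteq> ground \<Phi>"
      using A' by simp
    then obtain D' where D': "D' \<subseteq> ground \<Psi>" "D = \<phi> ` D'"
      by (rule subset_groundE)
    then show "D \<in> faces \<Phi>"
      using * D psub[OF D'(1)] image_face_iff[OF D'(1)] by simp
  qed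
  then show ?thesis
    using image_face_iff[OF A] A A' by (simp add: circuits_def)
qed

text \<open>The order enters the isomorphism argument twice: here, for broken circuits, and in
  \<open>image_IA\<close>, where exchanged elements are compared.\<close>

lemma image_Min:
  assumes "A \<subseteq> ground \<Psi>" "A \<noteq> {}"
  shows "Min (\<phi> ` A) = \<phi> (Min A)"
proof -
  have "finite A"
    using assms finite_ground[OF oc(1)] finite_subset by blast
  moreover have "\<phi> x \<le> \<phi> y" if "x \<in> A" "y \<in> A" "x \<le> y" for x y
    using that assms(1) strict_mono_on_leD[OF mono] by blast
  moreover have "Min A \<in> A"
    using \<open>finite A\<close> assms(2) by simp
  ultimately show ?thesis
    by (intro Min_eqI) auto
qed

lemma image_broken_circuits: "broken_circuits \<Phi> = (`) \<phi> ` broken_circuits \<Psi>"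
proof -
  have circ: "circuits \<Phi> = (`) \<phi> ` circuits \<Psi>"
  proof -
    have sub: "C \<subseteq> ground \<Psi>" if "C \<in> circuits \<Psi>" for C
      using that by (simp add: circuits_def)
    have sub': "C \<subseteq> ground \<Phi>" if "C \<in> circuits \<Phi>" for C
      using that by (simp add: circuits_def)
    show ?thesis
    proof (intro equalityI subsetI)
      fix X assume X: "X \<in> circuits \<Phi>"
      then obtain A where "A \<subseteq> ground \<Psi>" "X = \<phi> ` A"
        using subset_groundE[OF sub'] by metis
      then show "X \<in> (`) \<phi> ` circuits \<Psi>"
        using X image_circuit_iff by simp
    next
      fix X assume "X \<in> (`) \<phi> ` circuits \<Psi>"
      then show "X \<in> circuits \<Phi>"
        using sub image_circuit_iff by auto
    qed
  qed
  have "\<phi> ` C - {Min (\<phi> ` C)} = \<phi> ` (C - {Min C})" if "C \<in> circuits \<Psi>" for C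
  proof -
    have "C \<subseteq> ground \<Psi>" "C \<noteq> {}" "Min C \<in> C"
      using that circuit_nonempty[OF oc(1)] circuit_Min[OF oc(1)] by (auto simp: circuits_def)
    then show ?thesis
      using image_Min[of C] bij_betw_imp_inj_on[OF bij] inj_on_image_set_diff[of \<phi> "ground \<Psi>" C "{Min C}"]
      by auto
  qed
  then show ?thesis
    unfolding broken_circuits_def circ Setcompr_eq_image Collect_mem_eq by (simp add: image_image)
qed

lemma image_nbc_basis_iff:
  assumes A: "A \<subseteq> ground \<Psi>"
  shows "\<phi> ` A \<in> bases (nbc \<Phi>) \<longleftrightarrow> A \<in> bases (nbc \<Psi>)"
proof -
  have "D \<subseteq> ground \<Psi>" if "D \<in> broken_circuits \<Psi>" for D
    using that by (auto simp: broken_circuits_def circuits_def)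
  then show ?thesis
    using image_basis_iff[OF A] image_subset_iff_iso[OF _ A]
    by (simp add: bases_nbc[OF oc(1)] bases_nbc[OF oc(2)] image_broken_circuits)
qed

lemma image_IA:
  assumes pure: "pure \<Psi>" "pure \<Phi>" and B: "B \<in> bases \<Psi>"
  shows "IA (\<phi> ` B) \<Phi> = \<phi> ` IA B \<Psi>"
proof -
  have inj: "inj_on \<phi> (ground \<Psi>)" and im: "\<phi> ` ground \<Psi> = ground \<Phi>"
    using bij by (auto simp: bij_betw_def)
  have BE: "B \<subseteq> ground \<Psi>"
    using B basis_face face_subset_ground[OF oc(1)] by blast
  have in_ground: "b' \<in> ground \<Psi>" if "insert b' X \<in> bases \<Psi>" for b' X
    using that basis_face face_subset_ground[OF oc(1)] by blast
  have in_ground': "b' \<in> ground \<Phi>" if "insert b' X \<in> bases \<Phi>" for b' X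
    using that basis_face face_subset_ground[OF oc(2)] by blast
  have B': "\<phi> ` B \<in> bases \<Phi>"
    using image_basis_iff[OF BE] B by blast
  have key: "(\<forall>b'. b' \<notin> \<phi> ` B \<longrightarrow> insert b' (\<phi> ` B - {\<phi> b}) \<in> bases \<Phi> \<longrightarrow> \<phi> b < b') \<longleftrightarrow>
    (\<forall>b'. b' \<notin> B \<longrightarrow> insert b' (B - {b}) \<in> bases \<Psi> \<longrightarrow> b < b')" if b: "b \<in> B" for b
  proof -
    have eq: "(\<phi> c \<notin> \<phi> ` B \<longrightarrow> insert (\<phi> c) (\<phi> ` B - {\<phi> b}) \<in> bases \<Phi> \<longrightarrow> \<phi> b < \<phi> c) \<longleftrightarrow>
      (c \<notin> B \<longrightarrow> insert c (B - {b}) \<in> bases \<Psi> \<longrightarrow> b < c)" if c: "c \<in> ground \<Psi>" for c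
    proof -
      have "insert (\<phi> c) (\<phi> ` B - {\<phi> b}) = \<phi> ` insert c (B - {b})"
        using inj_on_image_set_diff[OF inj, of B "{b}"] b BE by auto
      then have "insert (\<phi> c) (\<phi> ` B - {\<phi> b}) \<in> bases \<Phi> \<longleftrightarrow> insert c (B - {b}) \<in> bases \<Psi>"
        using image_basis_iff[of "insert c (B - {b})"] c BE by auto
      moreover have "\<phi> c \<in> \<phi> ` B \<longleftrightarrow> c \<in> B"
        using inj c BE by (simp add: inj_on_image_mem_iff)
      moreover have "\<phi> b < \<phi> c \<longleftrightarrow> b < c"
        using mono b c BE by (meson strict_mono_on_less subsetD)
      ultimately show ?thesis
        by simp
    qed
    \<comment> \<open>The exchange partner ranges over the whole type, but only elements of the
      ground set can yield a basis, and there \<phi> is a bijection.\<close>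
    have "(\<forall>b'. b' \<notin> \<phi> ` B \<longrightarrow> insert b' (\<phi> ` B - {\<phi> b}) \<in> bases \<Phi> \<longrightarrow> \<phi> b < b') \<longleftrightarrow>
      (\<forall>b'\<in>\<phi> ` ground \<Psi>. b' \<notin> \<phi> ` B \<longrightarrow> insert b' (\<phi> ` B - {\<phi> b}) \<in> bases \<Phi> \<longrightarrow> \<phi> b < b')"
      unfolding im using in_ground' by blast
    also have "\<dots> \<longleftrightarrow> (\<forall>c\<in>ground \<Psi>. c \<notin> B \<longrightarrow> insert c (B - {b}) \<in> bases \<Psi> \<longrightarrow> b < c)"
      using eq by simp
    finally show ?thesis
      using in_ground by blast
  qed
  have image_Collect: "{c \<in> \<phi> ` B. P c} = \<phi> ` {b \<in> B. Q b}"
    if "\<And>b. b \<in> B \<Longrightarrow> P (\<phi> b) \<longleftrightarrow> Q b" for P Q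
    using that by auto
  show ?thesis
    unfolding IA_eq[OF oc(1) pure(1) B] IA_eq[OF oc(2) pure(2) B']
    by (rule image_Collect) (rule key)
qed

text \<open>After rewriting by \<open>nbc_activity_poly_eq\<close> the summands involve activities
  in \<Psi> and \<Phi> themselves, which \<open>image_IA\<close> matches term by term.\<close>

lemma nbc_activity_poly_iso:
  assumes S: "\<Psi> \<in> QE \<inter> QC" "\<Phi> \<in> QE \<inter> QC"
  shows "nbc_activity_poly \<Psi> = nbc_activity_poly \<Phi>"
proof -
  have pure: "pure \<Psi>" "pure \<Phi>"
    using S QE_D[of \<Psi>] QE_D[of \<Phi>] by blast+
  have sub: "B \<subseteq> ground \<Psi>" if "B \<in> bases (nbc \<Psi>)" for B
    using that bases_nbc_subset[OF oc(1)] basis_face face_subset_ground[OF oc(1)] by blast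
  have sub': "B \<subseteq> ground \<Phi>" if "B \<in> bases (nbc \<Phi>)" for B
    using that bases_nbc_subset[OF oc(2)] basis_face face_subset_ground[OF oc(2)] by blast
  have "bij_betw ((`) \<phi>) (bases (nbc \<Psi>)) (bases (nbc \<Phi>))"
  proof (rule bij_betw_imageI)
    show "inj_on ((`) \<phi>) (bases (nbc \<Psi>))"
      using sub image_eq_iff_iso by (intro inj_onI) metis
    show "(`) \<phi> ` bases (nbc \<Psi>) = bases (nbc \<Phi>)"
    proof
      show "(`) \<phi> ` bases (nbc \<Psi>) \<subseteq> bases (nbc \<Phi>)"
        using sub image_nbc_basis_iff by auto
      show "bases (nbc \<Phi>) \<subseteq> (`) \<phi> ` bases (nbc \<Psi>)"
      proof
        fix X assume X: "X \<in> bases (nbc \<Phi>)"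
        then obtain A where "A \<subseteq> ground \<Psi>" "X = \<phi> ` A"
          using subset_groundE[OF sub'] by metis
        then show "X \<in> (`) \<phi> ` bases (nbc \<Psi>)"
          using X image_nbc_basis_iff by simp
      qed
    qed
  qed
  moreover have "card (IA B \<Psi>) = card (IA (\<phi> ` B) \<Phi>)" if "B \<in> bases (nbc \<Psi>)" for B
  proof -
    have B: "B \<in> bases \<Psi>"
      using that bases_nbc_subset[OF oc(1)] by blast
    have "IA B \<Psi> \<subseteq> ground \<Psi>"
      using sub[OF that] by (auto simp: IA_def internally_active_def)
    then have "inj_on \<phi> (IA B \<Psi>)"
      using bij by (meson bij_betw_def inj_on_subset)
    then show ?thesis
      using image_IA[OF pure B] by (simp add: card_image)
  qed
  ultimately show ?thesis
    unfolding nbc_activity_poly_eq[OF S(1)] nbc_activity_poly_eq[OF S(2)]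
    by (simp add: sum.reindex_bij_betw[of "(`) \<phi>", symmetric])
qed

end

section \<open>Minors\<close>

lemma restriction_simps [simp]:
  "ground (restriction \<Psi> A) = A"
  "I \<in> faces (restriction \<Psi> A) \<longleftrightarrow> I \<in> faces \<Psi> \<and> I \<subseteq> A"
  by (simp_all add: restriction_def ground_def faces_def)

lemma ground_contraction [simp]: "ground (contraction \<Psi> e) = ground \<Psi> - {e}"
  by (simp add: contraction_def ground_def)

lemma face_contraction:
  "J \<in> faces (contraction \<Psi> e) \<longleftrightarrow> J \<subseteq> ground \<Psi> - {e} \<and> insert e J \<in> faces \<Psi>"
  by (simp add: contraction_def ground_def faces_def)

lemma ocomplex_eqI: "ground \<Psi> = ground \<Phi> \<Longrightarrow> faces \<Psi> = faces \<Phi> \<Longrightarrow> \<Psi> = \<Phi>"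
  by (simp add: ground_def faces_def prod_eq_iff)

lemma ordered_complexI:
  assumes "finite (ground \<Psi>)" "{} \<in> faces \<Psi>" "\<And>I. I \<in> faces \<Psi> \<Longrightarrow> I \<subseteq> ground \<Psi>"
    "\<And>I J. I \<in> faces \<Psi> \<Longrightarrow> J \<subseteq> I \<Longrightarrow> J \<in> faces \<Psi>"
  shows "ordered_complex \<Psi>"
  unfolding ordered_complex_def using assms by blast

lemma ordered_complex_restriction:
  assumes "ordered_complex \<Psi>" "A \<subseteq> ground \<Psi>"
  shows "ordered_complex (restriction \<Psi> A)"
proof (rule ordered_complexI)
  show "finite (ground (restriction \<Psi> A))"
    using finite_subset[OF assms(2) finite_ground[OF assms(1)]] by simp
  show "{} \<in> faces (restriction \<Psi> A)"
    using empty_face[OF assms(1)] by simp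
  show "J \<in> faces (restriction \<Psi> A)" if "I \<in> faces (restriction \<Psi> A)" "J \<subseteq> I" for I J
    using that face_subset[OF assms(1), of I J] subset_trans[of J I A] by simp
qed simp

lemma circuits_restriction:
  assumes "A \<subseteq> ground \<Psi>"
  shows "C \<in> circuits (restriction \<Psi> A) \<longleftrightarrow> C \<in> circuits \<Psi> \<and> C \<subseteq> A"
proof (cases "C \<subseteq> A")
  case True
  then have "D \<in> faces (restriction \<Psi> A) \<longleftrightarrow> D \<in> faces \<Psi>" if "D \<subset> C" for D
    using that by auto
  then show ?thesis
    using True assms by (auto simp: circuits_def)
qed (simp add: circuits_def)

lemma QC_elimination:
  assumes "\<Psi> \<in> QC" "C1 \<in> circuits \<Psi>" "C2 \<in> circuits \<Psi>" "C1 \<noteq> C2" "c \<in> C1" "c \<in> C2"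
    "c < Max ((C1 - C2) \<union> (C2 - C1))"
  obtains C3 where "C3 \<in> circuits \<Psi>" "C3 \<subseteq> C1 \<union> C2 - {c}"
  using assms unfolding QC_def by blast

lemma QE_exchange:
  assumes "\<Psi> \<in> QE" "B1 \<in> bases \<Psi>" "B2 \<in> bases \<Psi>" "b1 \<in> B1" "b1 \<notin> B2" "b1 > Max (B2 - B1)"
  obtains b2 where "b2 \<in> B2" "b2 \<notin> B1" "insert b2 (B1 - {b1}) \<in> faces \<Psi>"
proof -
  have "b1 \<in> B1 - B2"
    using assms by simp
  then have "\<exists>b2\<in>B2 - B1. (B1 - {b1}) \<union> {b2} \<in> faces \<Psi>"
    using assms unfolding QE_def by blast
  then show ?thesis
    using that by auto
qed

lemma QC_restriction:
  assumes QC: "\<Psi> \<in> QC" and A: "A \<subseteq> ground \<Psi>"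
  shows "restriction \<Psi> A \<in> QC"
proof -
  have oc: "ordered_complex \<Psi>"
    using QC by (simp add: QC_def)
  have "\<exists>C3\<in>circuits (restriction \<Psi> A). C3 \<subseteq> C1 \<union> C2 - {c}"
    if C: "C1 \<in> circuits (restriction \<Psi> A)" "C2 \<in> circuits (restriction \<Psi> A)" "c \<in> C1 \<inter> C2"
      "C1 \<noteq> C2 \<and> c < Max ((C1 - C2) \<union> (C2 - C1))" for C1 C2 c
  proof -
    have C': "C1 \<in> circuits \<Psi>" "C2 \<in> circuits \<Psi>" "C1 \<subseteq> A" "C2 \<subseteq> A"
      using C(1,2) circuits_restriction[OF A] by simp_all
    obtain C3 where "C3 \<in> circuits \<Psi>" "C3 \<subseteq> C1 \<union> C2 - {c}"
      using QC_elimination[OF QC C'(1,2), of c] C(3,4) by auto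
    moreover from this have "C3 \<subseteq> A"
      using C'(3,4) by blast
    ultimately show ?thesis
      using circuits_restriction[OF A] by auto
  qed
  then show ?thesis
    using ordered_complex_restriction[OF oc A] by (simp add: QC_def)
qed

text \<open>The faces form a chain, so there is exactly one basis and the exchange condition is
  vacuous.\<close>

lemma restriction_singleton_QE:
  assumes oc: "ordered_complex \<Psi>" and e: "e \<in> ground \<Psi>"
  shows "restriction \<Psi> {e} \<in> QE"
proof -
  let ?R = "restriction \<Psi> {e}"
  have eq: "B1 = B2" if B: "B1 \<in> bases ?R" "B2 \<in> bases ?R" for B1 B2
  proof -
    have "B1 \<subseteq> {e}" "B2 \<subseteq> {e}"
      using B[THEN basis_face] by simp_all
    then have "B1 \<subseteq> B2 \<or> B2 \<subseteq> B1"
      by (auto simp: subset_singleton_iff)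
    then show ?thesis
      using basis_subset_face_imp_eq[OF B(1) basis_face[OF B(2)]]
        basis_subset_face_imp_eq[OF B(2) basis_face[OF B(1)]] by auto
  qed
  have "pure ?R"
    unfolding pure_def by (intro ballI arg_cong[where f = card] eq)
  moreover have "b \<notin> B1 - B2" if "B1 \<in> bases ?R" "B2 \<in> bases ?R" for B1 B2 b
    using eq[OF that] by simp
  moreover have "ordered_complex ?R"
    using ordered_complex_restriction[OF oc] e by simp
  ultimately show ?thesis
    unfolding QE_def by blast
qed

text \<open>Removing a coloop lowers the dimension, so the results on \<open>deletion\<close> do not
  apply to it; through this identity those on \<open>contraction\<close> do.\<close>

lemma contraction_coloop:
  assumes "ordered_complex \<Psi>" "coloop \<Psi> e"
  shows "contraction \<Psi> e = restriction \<Psi> (ground \<Psi> - {e})"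
proof (rule ocomplex_eqI)
  have "insert e J \<in> faces \<Psi> \<longleftrightarrow> J \<in> faces \<Psi>" for J
    using coloop_insert_face[OF assms] face_subset[OF assms(1), of "insert e J" J] by auto
  then show "faces (contraction \<Psi> e) = faces (restriction \<Psi> (ground \<Psi> - {e}))"
    by (auto simp: face_contraction)
qed simp

section \<open>Contraction at a vertex\<close>

context
  fixes \<Psi> :: "'a::linorder ocomplex" and e :: 'a
  assumes oc: "ordered_complex \<Psi>" and e: "{e} \<in> faces \<Psi>"
begin

lemma face_contraction_iff: "J \<in> faces (contraction \<Psi> e) \<longleftrightarrow> e \<notin> J \<and> insert e J \<in> faces \<Psi>"
  using face_subset_ground[OF oc, of "insert e J"] by (auto simp: face_contraction)

lemma ordered_complex_contraction: "ordered_complex (contraction \<Psi> e)"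
proof (rule ordered_complexI)
  show "finite (ground (contraction \<Psi> e))"
    using finite_ground[OF oc] by simp
  show "{} \<in> faces (contraction \<Psi> e)"
    using e face_contraction_iff by simp
  show "J \<in> faces (contraction \<Psi> e)" if "I \<in> faces (contraction \<Psi> e)" "J \<subseteq> I" for I J
    using that face_subset[OF oc, of "insert e I" "insert e J"] face_contraction_iff by auto
qed (simp add: face_contraction)

lemma basis_contraction_iff: "J \<in> bases (contraction \<Psi> e) \<longleftrightarrow> e \<notin> J \<and> insert e J \<in> bases \<Psi>"
proof
  assume J: "J \<in> bases (contraction \<Psi> e)"
  then have J': "e \<notin> J" "insert e J \<in> faces \<Psi>"
    using basis_face[OF J] face_contraction_iff by simp_all
  have "I = insert e J" if "I \<in> faces \<Psi>" "insert e J \<subseteq> I" for I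
  proof -
    have "I - {e} \<in> faces (contraction \<Psi> e)"
      using face_contraction_iff that by (auto simp: insert_absorb)
    then have "I - {e} = J"
      using basis_subset_face_imp_eq[OF J] that(2) J'(1) by blast
    then show ?thesis
      using that(2) by blast
  qed
  then have "insert e J \<in> bases \<Psi>"
    by (rule basisI[OF J'(2)])
  then show "e \<notin> J \<and> insert e J \<in> bases \<Psi>"
    using J'(1) by simp
next
  assume J: "e \<notin> J \<and> insert e J \<in> bases \<Psi>"
  have "I = J" if "I \<in> faces (contraction \<Psi> e)" "J \<subseteq> I" for I
  proof -
    have I: "e \<notin> I" "insert e I \<in> faces \<Psi>"
      using that(1) face_contraction_iff by simp_all
    then have "insert e I = insert e J"
      using basis_subset_face_imp_eq[of "insert e J" \<Psi>] J that(2) by blast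
    then show ?thesis
      using I J by (simp add: insert_ident)
  qed
  moreover have "J \<in> faces (contraction \<Psi> e)"
    using J basis_face[of _ \<Psi>] face_contraction_iff by simp
  ultimately show "J \<in> bases (contraction \<Psi> e)"
    by (rule basisI[rotated])
qed

text \<open>Adding \<open>e\<close> to both bases leaves \<open>B2 - B1\<close> unchanged, so the
  condition on its maximum carries over to \<Psi>; since \<open>b1\<close> differs from
  \<open>e\<close>, the exchanged face still contains \<open>e\<close>.\<close>

lemma QE_contraction:
  assumes QE: "\<Psi> \<in> QE"
  shows "contraction \<Psi> e \<in> QE"
proof -
  have fin: "finite B" if "B \<in> bases (contraction \<Psi> e)" for B
    using finite_face[OF ordered_complex_contraction basis_face[OF that]] .
  have card: "card B1 = card B2"
    if B: "B1 \<in> bases (contraction \<Psi> e)" "B2 \<in> bases (contraction \<Psi> e)" for B1 B2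
  proof -
    have "card (insert e B1) = card (insert e B2)"
      using pure_card[OF QE_D(2)[OF QE]] B basis_contraction_iff by simp
    then show ?thesis
      using fin B basis_contraction_iff by simp
  qed
  have exch: "\<exists>b2\<in>B2 - B1. (B1 - {b1}) \<union> {b2} \<in> faces (contraction \<Psi> e)"
    if B: "B1 \<in> bases (contraction \<Psi> e)" "B2 \<in> bases (contraction \<Psi> e)" "b1 \<in> B1 - B2"
      "b1 > Max (B2 - B1)" for B1 B2 b1
  proof -
    have B': "e \<notin> B1" "e \<notin> B2" "insert e B1 \<in> bases \<Psi>" "insert e B2 \<in> bases \<Psi>"
      using B(1,2) basis_contraction_iff by simp_all
    have "insert e B2 - insert e B1 = B2 - B1"
      using B'(2) by blast
    then obtain b2 where b2: "b2 \<in> insert e B2" "b2 \<notin> insert e B1"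
      "insert b2 (insert e B1 - {b1}) \<in> faces \<Psi>"
      using QE_exchange[OF QE B'(3,4), of b1] B(3,4) B'(1) by auto
    moreover have "insert b2 (insert e B1 - {b1}) = insert e (insert b2 (B1 - {b1}))"
      using B(3) B'(1) by auto
    ultimately show ?thesis
      using face_contraction_iff B'(1) by (intro bexI[of _ b2]) auto
  qed
  show ?thesis
    by (rule QE_I[OF ordered_complex_contraction card exch])
qed

lemma circuit_contraction_iff:
  "D \<in> circuits (contraction \<Psi> e) \<longleftrightarrow>
    D \<subseteq> ground \<Psi> - {e} \<and> insert e D \<notin> faces \<Psi> \<and> (\<forall>D'. D' \<subset> D \<longrightarrow> insert e D' \<in> faces \<Psi>)"
  by (auto simp: circuits_def face_contraction)

text \<open>Some circuit lies in the dependent set \<open>insert e D\<close>. If it missed an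
  element of \<open>D\<close>, minimality of \<open>D\<close> in the contraction would make it a
  face.\<close>

lemma circuit_contraction_lift:
  assumes "D \<in> circuits (contraction \<Psi> e)"
  obtains C where "C \<in> circuits \<Psi>" "C - {e} = D"
proof -
  have D: "D \<subseteq> ground \<Psi> - {e}" "insert e D \<notin> faces \<Psi>" "\<And>D'. D' \<subset> D \<Longrightarrow> insert e D' \<in> faces \<Psi>"
    using assms circuit_contraction_iff by simp_all
  have "insert e D \<subseteq> ground \<Psi>"
    using D(1) face_subset_ground[OF oc e] by blast
  then obtain C where C: "C \<in> circuits \<Psi>" "C \<subseteq> insert e D"
    using dependent_contains_circuit[OF oc _ D(2)] by metis
  have "C - {e} = D"
  proof (rule ccontr)
    assume "C - {e} \<noteq> D"
    then have "C - {e} \<subset> D"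
      using C(2) by blast
    then have "C \<in> faces \<Psi>"
      using face_subset[OF oc D(3), of "C - {e}" C] by blast
    then show False
      using C(1) by (simp add: circuits_def)
  qed
  then show ?thesis
    using that C(1) by simp
qed

text \<open>The set \<open>C - {e}\<close> is dependent in the contraction but need not be minimal,
  hence an inclusion only.\<close>

lemma circuit_contraction_subset:
  assumes "C \<in> circuits \<Psi>"
  obtains D where "D \<in> circuits (contraction \<Psi> e)" "D \<subseteq> C - {e}"
proof -
  have "insert e (C - {e}) \<notin> faces \<Psi>"
    using assms face_subset[OF oc, of "insert e (C - {e})" C] by (auto simp: circuits_def)
  then have "C - {e} \<notin> faces (contraction \<Psi> e)"
    using face_contraction_iff by simp
  moreover have "C - {e} \<subseteq> ground (contraction \<Psi> e)"
    using assms by (auto simp: circuits_def)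
  ultimately show ?thesis
    using dependent_contains_circuit[OF ordered_complex_contraction] that by metis
qed

text \<open>Lifting the circuits can only add \<open>e\<close> to their symmetric difference. Its
  maximum does not decrease, so the side condition survives; the circuit eliminated in \<Psi> is
  then shrunk to one of the contraction.\<close>

lemma QC_contraction:
  assumes QC: "\<Psi> \<in> QC"
  shows "contraction \<Psi> e \<in> QC"
proof -
  have "\<exists>D3\<in>circuits (contraction \<Psi> e). D3 \<subseteq> D1 \<union> D2 - {c}"
    if D: "D1 \<in> circuits (contraction \<Psi> e)" "D2 \<in> circuits (contraction \<Psi> e)" "c \<in> D1 \<inter> D2"
      "D1 \<noteq> D2 \<and> c < Max ((D1 - D2) \<union> (D2 - D1))" for D1 D2 c
  proof -
    obtain C1 where C1: "C1 \<in> circuits \<Psi>" "C1 - {e} = D1"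
      using circuit_contraction_lift[OF D(1)] .
    obtain C2 where C2: "C2 \<in> circuits \<Psi>" "C2 - {e} = D2"
      using circuit_contraction_lift[OF D(2)] .
    have "finite ((C1 - C2) \<union> (C2 - C1))"
      using circuit_finite[OF oc C1(1)] circuit_finite[OF oc C2(1)] by simp
    moreover have "(D1 - D2) \<union> (D2 - D1) \<subseteq> (C1 - C2) \<union> (C2 - C1)"
      using C1(2) C2(2) by blast
    moreover have "(D1 - D2) \<union> (D2 - D1) \<noteq> {}"
      using D(4) by blast
    ultimately have "Max ((D1 - D2) \<union> (D2 - D1)) \<le> Max ((C1 - C2) \<union> (C2 - C1))"
      by (intro Max_mono)
    then have "c < Max ((C1 - C2) \<union> (C2 - C1))"
      using D(4) less_le_trans by blast
    moreover have "c \<in> C1" "c \<in> C2" "C1 \<noteq> C2"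
      using D(3,4) C1(2) C2(2) by auto
    ultimately obtain C3 where C3: "C3 \<in> circuits \<Psi>" "C3 \<subseteq> C1 \<union> C2 - {c}"
      using QC_elimination[OF QC C1(1) C2(1)] by metis
    obtain D3 where "D3 \<in> circuits (contraction \<Psi> e)" "D3 \<subseteq> C3 - {e}"
      using circuit_contraction_subset[OF C3(1)] .
    moreover from this have "D3 \<subseteq> D1 \<union> D2 - {c}"
      using C3(2) C1(2) C2(2) by blast
    ultimately show ?thesis
      by blast
  qed
  then show ?thesis
    using ordered_complex_contraction by (simp add: QC_def)
qed

text \<open>Broken circuits are compared through pairs of a circuit \<open>C\<close> of \<Psi> and a
  circuit \<open>D\<close> of the contraction with \<open>D \<subseteq> C\<close>. The point in both
  directions is that \<open>D\<close> contains \<open>Min C\<close>, so that the two minima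
  agree.\<close>

lemma nbc_basis_contraction_iff:
  assumes notMin: "\<And>C. C \<in> circuits \<Psi> \<Longrightarrow> Min C \<noteq> e"
  shows "J \<in> bases (nbc (contraction \<Psi> e)) \<longleftrightarrow> e \<notin> J \<and> insert e J \<in> bases (nbc \<Psi>)"
proof -
  note occ = ordered_complex_contraction
  have Min_eq: "Min D = Min C" if "C \<in> circuits \<Psi>" "D \<subseteq> C" "Min C \<in> D" for C D
  proof (rule Min_eqI)
    show "finite D"
      using circuit_finite[OF oc that(1)] that(2) finite_subset by blast
    show "Min C \<le> x" if "x \<in> D" for x
      using that circuit_finite[OF oc \<open>C \<in> circuits \<Psi>\<close>] \<open>D \<subseteq> C\<close> by auto
  qed (rule that(3))
  have "(\<forall>D\<in>circuits (contraction \<Psi> e). \<not> D - {Min D} \<subseteq> J) \<longleftrightarrow>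
      (\<forall>C\<in>circuits \<Psi>. \<not> C - {Min C} \<subseteq> insert e J)"
    if J: "J \<in> bases (contraction \<Psi> e)"
  proof (intro iffI ballI notI)
    fix C assume nbc: "\<forall>D\<in>circuits (contraction \<Psi> e). \<not> D - {Min D} \<subseteq> J"
      and C: "C \<in> circuits \<Psi>" "C - {Min C} \<subseteq> insert e J"
    obtain D where D: "D \<in> circuits (contraction \<Psi> e)" "D \<subseteq> C - {e}"
      using circuit_contraction_subset[OF C(1)] .
    \<comment> \<open>Otherwise \<open>D\<close> would avoid both \<open>Min C\<close> and
      \<open>e\<close> and thus lie in \<open>J\<close>, which is independent in the
      contraction.\<close>
    have "Min C \<in> D"
    proof (rule ccontr)
      assume "Min C \<notin> D"
      then have "D \<subseteq> J"
        using D(2) C(2) by blast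
      then have "D \<in> faces (contraction \<Psi> e)"
        using face_subset[OF occ basis_face[OF J]] by blast
      then show False
        using D(1) by (simp add: circuits_def)
    qed
    then have "Min D = Min C"
      using Min_eq[OF C(1)] D(2) by blast
    then have "D - {Min D} \<subseteq> J"
      using D(2) C(2) by auto
    then show False
      using nbc D(1) by simp
  next
    fix D assume nbc: "\<forall>C\<in>circuits \<Psi>. \<not> C - {Min C} \<subseteq> insert e J"
      and D: "D \<in> circuits (contraction \<Psi> e)" "D - {Min D} \<subseteq> J"
    obtain C where C: "C \<in> circuits \<Psi>" "C - {e} = D"
      using circuit_contraction_lift[OF D(1)] .
    \<comment> \<open>Here \<open>notMin\<close> enters: taking \<open>e\<close> out of
      \<open>C\<close> leaves its minimum in place.\<close>
    have "Min C \<in> D"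
      using C circuit_Min[OF oc C(1)] notMin[OF C(1)] by blast
    then have "Min D = Min C"
      using Min_eq[OF C(1)] C(2) by blast
    then have "C - {Min C} \<subseteq> insert e J"
      using D(2) C(2) by auto
    then show False
      using nbc C(1) by simp
  qed
  then show ?thesis
    unfolding nbc_basis_iff[OF oc] nbc_basis_iff[OF occ] using basis_contraction_iff by auto
qed

text \<open>An exchange partner for \<open>b \<in> J\<close> is never \<open>e\<close>: in \<Psi>
  because \<open>e\<close> already belongs to the basis, in the contraction because \<open>e\<close>
  is not in its ground set. All other exchanges correspond.\<close>

lemma IA_contraction:
  assumes pure: "pure \<Psi>" "pure (contraction \<Psi> e)" and J: "J \<in> bases (contraction \<Psi> e)"
  shows "IA J (contraction \<Psi> e) = IA (insert e J) \<Psi> - {e}"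
proof -
  have J': "e \<notin> J" "insert e J \<in> bases \<Psi>"
    using J basis_contraction_iff by simp_all
  have "insert b' (J - {b}) \<in> bases (contraction \<Psi> e) \<longleftrightarrow> insert b' (insert e J - {b}) \<in> bases \<Psi>"
    if "b \<in> J" "b' \<noteq> e" for b b'
  proof -
    have "insert b' (insert e J - {b}) = insert e (insert b' (J - {b}))"
      using that J'(1) by auto
    then show ?thesis
      using that J'(1) basis_contraction_iff by auto
  qed
  moreover have "insert e (J - {b}) \<notin> bases (contraction \<Psi> e)" for b
    using basis_contraction_iff by simp
  ultimately show ?thesis
    unfolding IA_eq[OF ordered_complex_contraction pure(2) J] IA_eq[OF oc pure(1) J'(2)]
    using J'(1) by auto metis+
qed

end

text \<open>
  The hypothesis \<open>avoid\<close> says that \<open>deletion \<Psi> e\<close> keeps the dimension of \<open>\<Psi>\<close>; it holds for loops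
  and, by \<open>QE\<close>, for the largest non-coloop vertex.
\<close>

context
  fixes \<Psi> :: "'a::linorder ocomplex" and e :: 'a
  assumes oc: "ordered_complex \<Psi>"
    and avoid: "\<And>I. I \<in> faces \<Psi> \<Longrightarrow> e \<notin> I \<Longrightarrow> \<exists>B\<in>bases \<Psi>. I \<subseteq> B \<and> e \<notin> B"
begin

lemma face_deletion_iff: "I \<in> faces (deletion \<Psi> e) \<longleftrightarrow> I \<in> faces \<Psi> \<and> e \<notin> I"
  using face_subset_ground[OF oc, of I] by (auto simp: deletion_def)

lemma ordered_complex_deletion: "ordered_complex (deletion \<Psi> e)"
  unfolding deletion_def using ordered_complex_restriction[OF oc] by blast

lemma basis_deletion_iff: "B \<in> bases (deletion \<Psi> e) \<longleftrightarrow> B \<in> bases \<Psi> \<and> e \<notin> B"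
proof
  assume B: "B \<in> bases (deletion \<Psi> e)"
  then have B': "B \<in> faces \<Psi>" "e \<notin> B"
    using basis_face[OF B] face_deletion_iff by simp_all
  then obtain B0 where B0: "B0 \<in> bases \<Psi>" "B \<subseteq> B0" "e \<notin> B0"
    using avoid by blast
  then have "B0 \<in> faces (deletion \<Psi> e)"
    using basis_face[of B0 \<Psi>] face_deletion_iff by simp
  then have "B0 = B"
    using basis_subset_face_imp_eq[OF B] B0(2) by simp
  then show "B \<in> bases \<Psi> \<and> e \<notin> B"
    using B0 by simp
next
  assume "B \<in> bases \<Psi> \<and> e \<notin> B"
  then show "B \<in> bases (deletion \<Psi> e)"
    using face_deletion_iff by (simp add: bases_def)
qed

text \<open>The exchange stays inside \<open>B1 \<union> B2\<close>, hence away from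
  \<open>e\<close>.\<close>

lemma QE_deletion:
  assumes QE: "\<Psi> \<in> QE"
  shows "deletion \<Psi> e \<in> QE"
proof -
  have exch: "\<exists>b2\<in>B2 - B1. (B1 - {b1}) \<union> {b2} \<in> faces (deletion \<Psi> e)"
    if B: "B1 \<in> bases (deletion \<Psi> e)" "B2 \<in> bases (deletion \<Psi> e)" "b1 \<in> B1 - B2"
      "b1 > Max (B2 - B1)" for B1 B2 b1
  proof -
    have B': "e \<notin> B1" "e \<notin> B2" "B1 \<in> bases \<Psi>" "B2 \<in> bases \<Psi>"
      using B(1,2) basis_deletion_iff by simp_all
    obtain b2 where b2: "b2 \<in> B2" "b2 \<notin> B1" "insert b2 (B1 - {b1}) \<in> faces \<Psi>"
      using QE_exchange[OF QE B'(3,4), of b1] B(3,4) by auto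
    then show ?thesis
      using face_deletion_iff B'(1,2) by (intro bexI[of _ b2]) auto
  qed
  have card: "card B1 = card B2"
    if "B1 \<in> bases (deletion \<Psi> e)" "B2 \<in> bases (deletion \<Psi> e)" for B1 B2
    using that pure_card[OF QE_D(2)[OF QE]] basis_deletion_iff by simp
  show ?thesis
    by (rule QE_I[OF ordered_complex_deletion card exch])
qed

lemma circuit_deletion_iff: "C \<in> circuits (deletion \<Psi> e) \<longleftrightarrow> C \<in> circuits \<Psi> \<and> e \<notin> C"
  unfolding deletion_def using circuits_restriction[of "ground \<Psi> - {e}" \<Psi> C]
  by (auto simp: circuits_def)

text \<open>The deletion loses just the circuits through \<open>e\<close>. As \<open>e\<close> is
  not their minimum, it stays in their broken circuits, which therefore cannot lie in a basis
  avoiding \<open>e\<close>.\<close>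

lemma nbc_basis_deletion_iff:
  assumes notMin: "\<And>C. C \<in> circuits \<Psi> \<Longrightarrow> Min C \<noteq> e"
  shows "B \<in> bases (nbc (deletion \<Psi> e)) \<longleftrightarrow> B \<in> bases (nbc \<Psi>) \<and> e \<notin> B"
proof -
  have "e \<notin> C" if "C \<in> circuits \<Psi>" "C - {Min C} \<subseteq> B" "e \<notin> B" for C
    using that notMin[OF that(1)] by blast
  then show ?thesis
    unfolding nbc_basis_iff[OF oc] nbc_basis_iff[OF ordered_complex_deletion]
    using basis_deletion_iff circuit_deletion_iff by auto
qed

text \<open>The exchanges lost in the deletion are those bringing in \<open>e\<close>. By
  \<open>less\<close> they replace \<open>b\<close> by something larger, so they never prevent
  \<open>b\<close> from being active.\<close>

lemma IA_deletion:
  assumes pure: "pure \<Psi>" "pure (deletion \<Psi> e)" and B: "B \<in> bases (deletion \<Psi> e)"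
    and less: "\<And>b. b \<in> B \<Longrightarrow> insert e (B - {b}) \<in> bases \<Psi> \<Longrightarrow> b < e"
  shows "IA B (deletion \<Psi> e) = IA B \<Psi>"
proof -
  have B': "B \<in> bases \<Psi>" "e \<notin> B"
    using B basis_deletion_iff by simp_all
  have "insert b' (B - {b}) \<in> bases (deletion \<Psi> e) \<longleftrightarrow> insert b' (B - {b}) \<in> bases \<Psi> \<and> b' \<noteq> e"
    for b b'
    using basis_deletion_iff B'(2) by auto
  then show ?thesis
    unfolding IA_eq[OF ordered_complex_deletion pure(2) B] IA_eq[OF oc pure(1) B'(1)]
    using less by auto
qed

end

section \<open>Loops, coloops, and deletion-contraction\<close>

lemma coloop_face:
  assumes "ordered_complex \<Psi>" "coloop \<Psi> e"
  shows "{e} \<in> faces \<Psi>"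
  using coloop_insert_face[OF assms empty_face[OF assms(1)]] .

text \<open>The broken circuit of \<open>{e}\<close> is the empty set, which every basis
  contains.\<close>

lemma loop_nbc_activity_poly:
  assumes oc: "ordered_complex \<Psi>" and e: "loop \<Psi> e"
  shows "nbc_activity_poly \<Psi> = 0"
proof -
  have e': "e \<in> ground \<Psi>" "{e} \<notin> faces \<Psi>"
    using e loop_iff[OF oc] by simp_all
  then have "{e} \<in> circuits \<Psi>"
    using empty_face[OF oc] by (auto simp: circuits_def psubset_eq subset_singleton_iff)
  then have "B \<notin> bases (nbc \<Psi>)" for B
    using nbc_basis_iff[OF oc] by force
  then have "bases (nbc \<Psi>) = {}"
    by blast
  then show ?thesis
    by (simp add: nbc_activity_poly_def)
qed

lemma restriction_singleton_QE_QC: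
  assumes "\<Psi> \<in> QE \<inter> QC" "e \<in> ground \<Psi>"
  shows "restriction \<Psi> {e} \<in> QE \<inter> QC"
  using assms QC_restriction[of \<Psi> "{e}"] restriction_singleton_QE[of \<Psi> e] QE_D(1)[of \<Psi>] by simp

lemma coloop_nbc_activity_poly_singleton:
  fixes \<Psi> :: "'a::linorder ocomplex"
  assumes S: "\<Psi> \<in> QE \<inter> QC" and e: "coloop \<Psi> e"
  shows "nbc_activity_poly (restriction \<Psi> {e}) = monom 1 1"
proof -
  let ?R = "restriction \<Psi> {e}"
  have oc: "ordered_complex \<Psi>"
    using S QE_D(1)[of \<Psi>] by simp
  have eg: "e \<in> ground \<Psi>"
    using e by (simp add: coloop_def)
  note R = restriction_singleton_QE_QC[OF S eg]
  have ocR: "ordered_complex ?R" and pureR: "pure ?R"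
    using R QE_D[of ?R] by simp_all
  have bR: "B \<in> bases ?R \<longleftrightarrow> B = {e}" for B
    using coloop_face[OF oc e] by (auto simp: bases_def subset_singleton_iff)
  have "C \<notin> circuits ?R" for C
  proof
    assume "C \<in> circuits ?R"
    then have C: "C \<in> circuits \<Psi>" "C \<subseteq> {e}"
      using circuits_restriction[of "{e}" \<Psi> C] eg by simp_all
    then show False
      using circuit_no_coloop[OF oc C(1) e] circuit_nonempty[OF oc C(1)] by blast
  qed
  then have "circuits ?R = {}"
    by blast
  then have "B \<in> bases (nbc ?R) \<longleftrightarrow> B = {e}" for B
    unfolding nbc_basis_iff[OF ocR] using bR by simp
  then have nbc: "bases (nbc ?R) = {{e}}"
    by blast
  have "IA {e} ?R = {e}"
    using IA_eq[OF ocR pureR, of "{e}"] bR by auto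
  then show ?thesis
    unfolding nbc_activity_poly_eq[OF R] nbc by simp
qed

lemma contraction_QE_QC:
  assumes "\<Psi> \<in> QE \<inter> QC" "{e} \<in> faces \<Psi>"
  shows "contraction \<Psi> e \<in> QE \<inter> QC"
  using assms QE_contraction[of \<Psi> e] QC_contraction[of \<Psi> e] QE_D(1)[of \<Psi>] by simp

text \<open>Shared by coloops and the largest non-coloop vertex. Removing \<open>e\<close> from the
  active set lowers each exponent by one in the first case and changes nothing in the
  second.\<close>

lemma nbc_activity_poly_contraction:
  fixes \<Psi> :: "'a::linorder ocomplex"
  assumes S: "\<Psi> \<in> QE \<inter> QC" and e: "{e} \<in> faces \<Psi>"
    and notMin: "\<And>C. C \<in> circuits \<Psi> \<Longrightarrow> Min C \<noteq> e"
  shows "nbc_activity_poly (contraction \<Psi> e) =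
    (\<Sum>B | B \<in> bases (nbc \<Psi>) \<and> e \<in> B. monom 1 (card (IA B \<Psi> - {e})))"
proof -
  have oc: "ordered_complex \<Psi>" and pure: "pure \<Psi>"
    using S QE_D[of \<Psi>] by simp_all
  note con = contraction_QE_QC[OF S e]
  have pure': "pure (contraction \<Psi> e)"
    using con QE_D[of "contraction \<Psi> e"] by simp
  have nbc: "J \<in> bases (nbc (contraction \<Psi> e)) \<longleftrightarrow> e \<notin> J \<and> insert e J \<in> bases (nbc \<Psi>)" for J
    using nbc_basis_contraction_iff[OF oc e notMin] .
  show ?thesis
    unfolding nbc_activity_poly_eq[OF con]
  proof (rule sum.reindex_bij_witness[where i = "\<lambda>B. B - {e}" and j = "insert e"])
    fix J assume J: "J \<in> bases (nbc (contraction \<Psi> e))"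
    have "J \<in> bases (contraction \<Psi> e)"
      using J bases_nbc_subset[OF ordered_complex_contraction[OF oc e]] by blast
    then show "monom 1 (card (IA (insert e J) \<Psi> - {e})) = monom (1::int) (card (IA J (contraction \<Psi> e)))"
      using IA_contraction[OF oc e pure pure'] by simp
    show "insert e J - {e} = J" "insert e J \<in> {B. B \<in> bases (nbc \<Psi>) \<and> e \<in> B}"
      using J nbc by simp_all
  next
    fix B assume B: "B \<in> {B. B \<in> bases (nbc \<Psi>) \<and> e \<in> B}"
    then show "insert e (B - {e}) = B"
      by auto
    then show "B - {e} \<in> bases (nbc (contraction \<Psi> e))"
      using B nbc by simp
  qed
qed

lemma loop_avoid:
  assumes oc: "ordered_complex \<Psi>" and "loop \<Psi> e" "I \<in> faces \<Psi>"
  shows "\<exists>B\<in>bases \<Psi>. I \<subseteq> B \<and> e \<notin> B"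
  using face_extends_to_basis[OF oc assms(3)] assms(2) unfolding loop_def by metis

text \<open>Both sides of the product formula vanish, because \<open>e\<close> is also a loop of
  \<open>restriction \<Psi> {e}\<close>.\<close>

lemma loop_recursion:
  fixes \<Psi> :: "'a::linorder ocomplex"
  assumes S: "\<Psi> \<in> QE \<inter> QC" and e: "loop \<Psi> e"
  shows "restriction \<Psi> (ground \<Psi> - {e}) \<in> QE \<inter> QC"
    and "nbc_activity_poly \<Psi> =
      nbc_activity_poly (restriction \<Psi> {e}) * nbc_activity_poly (restriction \<Psi> (ground \<Psi> - {e}))"
proof -
  have oc: "ordered_complex \<Psi>"
    using S QE_D[of \<Psi>] by simp
  have eg: "e \<in> ground \<Psi>"
    using e by (simp add: loop_def)
  have "deletion \<Psi> e \<in> QE"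
    using S by (intro QE_deletion[OF oc loop_avoid[OF oc e]]) simp_all
  then show "restriction \<Psi> (ground \<Psi> - {e}) \<in> QE \<inter> QC"
    using S QC_restriction[of \<Psi> "ground \<Psi> - {e}"] by (auto simp: deletion_def)
  have ocR: "ordered_complex (restriction \<Psi> {e})"
    using ordered_complex_restriction[OF oc, of "{e}"] eg by simp
  have "loop (restriction \<Psi> {e}) e"
    using e loop_iff[OF oc] loop_iff[OF ocR] by simp
  then show "nbc_activity_poly \<Psi> =
      nbc_activity_poly (restriction \<Psi> {e}) * nbc_activity_poly (restriction \<Psi> (ground \<Psi> - {e}))"
    using loop_nbc_activity_poly[OF oc e] loop_nbc_activity_poly[OF ocR] by simp
qed

lemma coloop_recursion:
  fixes \<Psi> :: "'a::linorder ocomplex"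
  assumes S: "\<Psi> \<in> QE \<inter> QC" and e: "coloop \<Psi> e"
  shows "restriction \<Psi> (ground \<Psi> - {e}) \<in> QE \<inter> QC"
    and "nbc_activity_poly \<Psi> =
      nbc_activity_poly (restriction \<Psi> {e}) * nbc_activity_poly (restriction \<Psi> (ground \<Psi> - {e}))"
proof -
  have oc: "ordered_complex \<Psi>" and pure: "pure \<Psi>"
    using S QE_D[of \<Psi>] by simp_all
  note ef = coloop_face[OF oc e]
  note con = contraction_coloop[OF oc e, symmetric]
  show "restriction \<Psi> (ground \<Psi> - {e}) \<in> QE \<inter> QC"
    unfolding con using contraction_QE_QC[OF S ef] .
  have notMin: "Min C \<noteq> e" if "C \<in> circuits \<Psi>" for C
    using circuit_no_coloop[OF oc that e] circuit_Min[OF oc that] by auto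
  have eB: "e \<in> B" if "B \<in> bases \<Psi>" for B
    using e that by (simp add: coloop_def)
  have "{B. B \<in> bases (nbc \<Psi>) \<and> e \<in> B} = bases (nbc \<Psi>)"
    using eB bases_nbc_subset[OF oc] by blast
  moreover have "card (IA B \<Psi>) = Suc (card (IA B \<Psi> - {e}))" if "B \<in> bases (nbc \<Psi>)" for B
  proof -
    have B: "B \<in> bases \<Psi>"
      using that bases_nbc_subset[OF oc] by blast
    \<comment> \<open>Every basis contains the coloop, so the only element that can replace
      \<open>e\<close> is \<open>e\<close> itself; the activity condition at \<open>e\<close> is
      vacuous.\<close>
    have "b' = e" if "insert b' (B - {e}) \<in> bases \<Psi>" for b'
      using eB[OF that] by simp
    then have "e \<in> IA B \<Psi>"
      using IA_eq[OF oc pure B] eB[OF B] by auto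
    moreover have "finite (IA B \<Psi>)"
      using IA_eq[OF oc pure B] finite_face[OF oc basis_face[OF B]] by simp
    ultimately show ?thesis
      by (rule card.remove[rotated])
  qed
  moreover have "nbc_activity_poly (contraction \<Psi> e) =
      (\<Sum>B | B \<in> bases (nbc \<Psi>) \<and> e \<in> B. monom 1 (card (IA B \<Psi> - {e})))"
    using nbc_activity_poly_contraction[OF S ef notMin] .
  ultimately show "nbc_activity_poly \<Psi> =
      nbc_activity_poly (restriction \<Psi> {e}) * nbc_activity_poly (restriction \<Psi> (ground \<Psi> - {e}))"
    unfolding con coloop_nbc_activity_poly_singleton[OF S e] nbc_activity_poly_eq[OF S]
    by (simp add: sum_distrib_left mult_monom)
qed

section \<open>The largest non-coloop vertex\<close>

context
  fixes \<Psi> :: "'a::linorder ocomplex" and e :: 'a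
  assumes S: "\<Psi> \<in> QE \<inter> QC" and e: "largest_noncoloop_vertex \<Psi> e"
begin

lemma S_ordered_complex: "ordered_complex \<Psi>" and S_pure: "pure \<Psi>"
  using S QE_D[of \<Psi>] by simp_all

lemma largest_face: "{e} \<in> faces \<Psi>"
  using e vertex_iff[OF S_ordered_complex] by (simp add: largest_noncoloop_vertex_def)

text \<open>An element lying in one basis but not in another is a vertex and not a coloop. Hence all
  bases agree above \<open>e\<close>, which is how the maximality of \<open>e\<close> is used on
  bases.\<close>

lemma vertex_missing_le:
  assumes "B \<in> bases \<Psi>" "B' \<in> bases \<Psi>" "b \<in> B" "b \<notin> B'"
  shows "b \<le> e"
proof -
  have "vertex \<Psi> b"
    using assms(3) vertex_iff[OF S_ordered_complex]
      face_subset[OF S_ordered_complex basis_face[OF assms(1)], of "{b}"] by simp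
  moreover have "\<not> coloop \<Psi> b"
    using assms(2,4) by (auto simp: coloop_def)
  ultimately show ?thesis
    using e by (simp add: largest_noncoloop_vertex_def)
qed

text \<open>As \<open>e\<close> is no coloop, some basis \<open>B2\<close> avoids it. By
  \<open>vertex_missing_le\<close> all of \<open>B2 - B\<close> lies below \<open>e\<close>, which
  is the side condition under which \<open>QE\<close> allows \<open>e\<close> to be
  exchanged.\<close>

lemma largest_exchange:
  assumes B: "B \<in> bases \<Psi>" and eB: "e \<in> B"
  obtains b where "b \<notin> B" "b < e" "insert b (B - {e}) \<in> bases \<Psi>"
proof -
  have "\<not> coloop \<Psi> e" "e \<in> ground \<Psi>"
    using e by (simp_all add: largest_noncoloop_vertex_def vertex_def)
  then obtain B2 where B2: "B2 \<in> bases \<Psi>" "e \<notin> B2"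
    by (auto simp: coloop_def)
  have fin: "finite B2" "finite B"
    using finite_face[OF S_ordered_complex basis_face] B2(1) B by blast+
  have "b < e" if "b \<in> B2 - B" for b
    using that vertex_missing_le[OF B2(1) B, of b] eB by (auto simp: order_less_le)
  moreover have "B2 - B \<noteq> {}"
    using basis_subset_face_imp_eq[OF B2(1) basis_face[OF B]] eB B2(2) by blast
  ultimately have "Max (B2 - B) < e"
    using fin by simp
  then obtain b where b: "b \<in> B2" "b \<notin> B" "insert b (B - {e}) \<in> faces \<Psi>"
    using QE_exchange[OF _ B B2(1) eB B2(2)] S by auto
  then have "insert b (B - {e}) \<in> bases \<Psi>" "b < e"
    using pure_exchange_basis[OF S_ordered_complex S_pure B eB] \<open>\<And>b. b \<in> B2 - B \<Longrightarrow> b < e\<close>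
    by simp_all
  then show ?thesis
    using that b(2) by simp
qed

lemma largest_avoid:
  assumes I: "I \<in> faces \<Psi>" "e \<notin> I"
  shows "\<exists>B\<in>bases \<Psi>. I \<subseteq> B \<and> e \<notin> B"
proof -
  obtain B where B: "B \<in> bases \<Psi>" "I \<subseteq> B"
    using face_extends_to_basis[OF S_ordered_complex I(1)] .
  show ?thesis
  proof (cases "e \<in> B")
    case True
    then obtain b where b: "b < e" "insert b (B - {e}) \<in> bases \<Psi>"
      using largest_exchange[OF B(1)] by metis
    moreover have "I \<subseteq> insert b (B - {e})"
      using B(2) I(2) by blast
    ultimately show ?thesis
      by (intro bexI[of _ "insert b (B - {e})"]) auto
  next
    case False
    then show ?thesis
      using B by blast
  qed
qed

text \<open>The elements of a circuit above \<open>e\<close> would be coloops.\<close>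

lemma largest_not_Min:
  assumes C: "C \<in> circuits \<Psi>"
  shows "Min C \<noteq> e"
proof
  note oc = S_ordered_complex
  assume Min: "Min C = e"
  then have eC: "e \<in> C"
    using circuit_Min[OF oc C] by simp
  have "C \<noteq> {e}"
    using C largest_face by (auto simp: circuits_def)
  then obtain c where c: "c \<in> C" "c \<noteq> e"
    using eC by blast
  then have "e < c"
    using Min circuit_finite[OF oc C] by (metis Min_le order_le_imp_less_or_eq)
  moreover have "\<not> coloop \<Psi> c"
    using circuit_no_coloop[OF oc C, of c] c(1) by auto
  moreover have "{c} \<subset> C"
    using c eC by blast
  then have "{c} \<in> faces \<Psi>"
    using C by (simp add: circuits_def)
  then have "vertex \<Psi> c"
    using vertex_iff[OF oc] by simp
  ultimately show False
    using e by (auto simp: largest_noncoloop_vertex_def)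
qed

lemma deletion_QE_QC: "deletion \<Psi> e \<in> QE \<inter> QC"
proof
  show "deletion \<Psi> e \<in> QE"
    using S by (intro QE_deletion[OF S_ordered_complex largest_avoid]) simp_all
  show "deletion \<Psi> e \<in> QC"
    unfolding deletion_def using S by (intro QC_restriction) auto
qed

lemma deletion_contraction:
  "nbc_activity_poly \<Psi> = nbc_activity_poly (contraction \<Psi> e) + nbc_activity_poly (deletion \<Psi> e)"
proof -
  note oc = S_ordered_complex
  let ?N = "bases (nbc \<Psi>)"
  have fin: "finite ?N"
    by (rule finite_bases_nbc[OF oc])
  have base: "B \<in> bases \<Psi>" if "B \<in> ?N" for B
    using that bases_nbc_subset[OF oc] by blast
  have IA_e: "e \<notin> IA B \<Psi>" if B: "B \<in> bases \<Psi>" "e \<in> B" for B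
  proof -
    obtain b where "b \<notin> B" "b < e" "insert b (B - {e}) \<in> bases \<Psi>"
      using largest_exchange[OF B] .
    then show ?thesis
      using IA_eq[OF oc S_pure B(1)] by auto
  qed
  have "nbc_activity_poly (contraction \<Psi> e) =
      (\<Sum>B | B \<in> ?N \<and> e \<in> B. monom 1 (card (IA B \<Psi> - {e})))"
    using nbc_activity_poly_contraction[OF S largest_face largest_not_Min] .
  also have "\<dots> = (\<Sum>B | B \<in> ?N \<and> e \<in> B. monom 1 (card (IA B \<Psi>)))"
    using IA_e base by (intro sum.cong) simp_all
  finally have 1: "nbc_activity_poly (contraction \<Psi> e) =
      (\<Sum>B | B \<in> ?N \<and> e \<in> B. monom 1 (card (IA B \<Psi>)))" .
  have nbc: "B \<in> bases (nbc (deletion \<Psi> e)) \<longleftrightarrow> B \<in> ?N \<and> e \<notin> B" for B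
    using nbc_basis_deletion_iff[OF oc largest_avoid largest_not_Min] .
  have 2: "nbc_activity_poly (deletion \<Psi> e) = (\<Sum>B | B \<in> ?N \<and> e \<notin> B. monom 1 (card (IA B \<Psi>)))"
    unfolding nbc_activity_poly_eq[OF deletion_QE_QC]
  proof (rule sum.cong)
    show "bases (nbc (deletion \<Psi> e)) = {B. B \<in> ?N \<and> e \<notin> B}"
      using nbc by blast
    fix B assume "B \<in> {B. B \<in> ?N \<and> e \<notin> B}"
    then have B: "B \<in> bases \<Psi>" "e \<notin> B"
      using base by simp_all
    \<comment> \<open>The element \<open>b\<close> lies in \<open>B\<close> but not in the exchanged
      basis, so \<open>vertex_missing_le\<close> bounds it by \<open>e\<close>.\<close>
    have less: "b < e" if "b \<in> B" "insert e (B - {b}) \<in> bases \<Psi>" for b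
      using vertex_missing_le[OF B(1) that(2,1)] that(1) B(2) by (auto simp: order_less_le)
    have "B \<in> bases (deletion \<Psi> e)"
      using basis_deletion_iff[OF oc largest_avoid] B by simp
    then have "IA B (deletion \<Psi> e) = IA B \<Psi>"
      using deletion_QE_QC QE_D(2)[of "deletion \<Psi> e"] less
      by (intro IA_deletion[OF oc largest_avoid S_pure]) simp_all
    then show "monom 1 (card (IA B (deletion \<Psi> e))) = monom (1::int) (card (IA B \<Psi>))"
      by simp
  qed
  have "nbc_activity_poly \<Psi> =
      (\<Sum>B\<in>{B. B \<in> ?N \<and> e \<in> B} \<union> {B. B \<in> ?N \<and> e \<notin> B}. monom 1 (card (IA B \<Psi>)))"
    unfolding nbc_activity_poly_eq[OF S] by (rule sum.cong) auto
  also have "\<dots> = nbc_activity_poly (contraction \<Psi> e) + nbc_activity_poly (deletion \<Psi> e)"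
    unfolding 1 2 using fin by (intro sum.union_disjoint) auto
  finally show ?thesis .
qed

end

theorem theorem6p5:
  shows "tutte_grothendieck_invariant (QE \<inter> QC :: 'a::linorder ocomplex set) nbc_activity_poly \<and>
         (\<forall>\<Psi> \<in> (QE \<inter> QC :: 'a ocomplex set). \<forall>B \<in> bases (nbc \<Psi>). IA B \<Psi> = IA B (nbc \<Psi>))"
proof -
  have "nbc_activity_poly \<Psi> = nbc_activity_poly \<Phi>"
    if S: "\<Psi> \<in> QE \<inter> QC" "\<Phi> \<in> QE \<inter> QC" and iso: "isomorphic \<Psi> \<Phi>" for \<Psi> \<Phi> :: "'a ocomplex"
  proof -
    obtain \<phi> where "bij_betw \<phi> (ground \<Psi>) (ground \<Phi>)" "strict_mono_on (ground \<Psi>) \<phi>"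
      "bij_betw ((`) \<phi>) (faces \<Psi>) (faces \<Phi>)"
      using iso unfolding isomorphic_def by metis
    then show ?thesis
      using S QE_D(1)[of \<Psi>] QE_D(1)[of \<Phi>] by (intro nbc_activity_poly_iso[of \<Psi> \<Phi> \<phi>]) simp_all
  qed
  moreover have "restriction \<Psi> {e} \<in> QE \<inter> QC \<and> restriction \<Psi> (ground \<Psi> - {e}) \<in> QE \<inter> QC \<and>
      nbc_activity_poly \<Psi> =
        nbc_activity_poly (restriction \<Psi> {e}) * nbc_activity_poly (restriction \<Psi> (ground \<Psi> - {e}))"
    if S: "\<Psi> \<in> QE \<inter> QC" and e: "loop \<Psi> e \<or> coloop \<Psi> e" for \<Psi> :: "'a ocomplex" and e
  proof -
    have "e \<in> ground \<Psi>"
      using e by (auto simp: loop_def coloop_def)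
    then show ?thesis
      using e restriction_singleton_QE_QC[OF S] loop_recursion[OF S] coloop_recursion[OF S] by metis
  qed
  moreover have "contraction \<Psi> e \<in> QE \<inter> QC \<and> deletion \<Psi> e \<in> QE \<inter> QC \<and>
      nbc_activity_poly \<Psi> = nbc_activity_poly (contraction \<Psi> e) + nbc_activity_poly (deletion \<Psi> e)"
    if S: "\<Psi> \<in> QE \<inter> QC" and e: "largest_noncoloop_vertex \<Psi> e" for \<Psi> :: "'a ocomplex" and e
    using contraction_QE_QC[OF S largest_face[OF S e]] deletion_QE_QC[OF S e]
      deletion_contraction[OF S e] by simp
  ultimately have "tutte_grothendieck_invariant (QE \<inter> QC :: 'a ocomplex set) nbc_activity_poly"
    unfolding tutte_grothendieck_invariant_def by simp
  then show ?thesis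
    by (intro conjI ballI IA_nbc)
qed

end
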